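(* Let $G$ be a connected bipartite graph on the vertex set $\{1,\dots,n\}$, let $R=k[x_1,\dots,x_n]$ be a polynomial ring over a field $k$, and let $I=I(G)\subset R$ be the edge ideal of $G$. Let $C_1,\dots,C_r$ be disjoint cycles of $G$, $r\ge 1$. Then $$\operatorname{dstab}(I)\le v(G)-\varepsilon_0(G)-\bigl(v(C_1)+\cdots+v(C_r)\bigr)/2+r.$$ Equality holds if these cycles $C_1,\dots,C_r$ are the only cycles of $G$ and all have lengths $\ge 6$.
   Context: All graphs are finite and simple. The edge ideal $I(G)$ is generated by the monomials $x_ix_j$ with $\{i,j\}$ an edge of $G$. For a homogeneous ideal $I$, $\operatorname{dstab}(I)$ is the smallest integer $s\ge 1$ such that $\operatorname{depth} R/I^t=\operatorname{depth} R/I^s$ for all $t\ge s$. For a graph $H$, $v(H)$ denotes the number of vertices of $H$, and $\varepsilon_0(H)$ denotes the number of leaf edges of $H$ (edges incident to a vertex of degree 1). Cycles are ordinary graph cycles (length at least 3), and disjoint means that no two of them have a common vertex. *)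

theory Defs
  imports Complex_Main "HOL-Library.Poly_Mapping" "HOL-Library.Extended_Nat"
begin

section \<open>Finite simple graphs\<close>

text \<open>A graph is a pair of a vertex set and a set of edges, an edge being a two-element set of
  vertices.\<close>

type_synonym 'v ugraph = "'v set \<times> 'v set set"

abbreviation verts :: "'v ugraph \<Rightarrow> 'v set" where "verts G \<equiv> fst G"
abbreviation edges :: "'v ugraph \<Rightarrow> 'v set set" where "edges G \<equiv> snd G"

definition simple_graph :: "'v ugraph \<Rightarrow> bool" where
  "simple_graph G \<longleftrightarrow> finite (verts G) \<and> (\<forall>e\<in>edges G. e \<subseteq> verts G \<and> card e = 2)"

definition connected_graph :: "'v ugraph \<Rightarrow> bool" where
  "connected_graph G \<longleftrightarrow> verts G \<noteq> {} \<and>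
     (\<forall>u\<in>verts G. \<forall>v\<in>verts G. (u, v) \<in> {(a, b). {a, b} \<in> edges G}\<^sup>*)"

definition bipartite :: "'v ugraph \<Rightarrow> bool" where
  "bipartite G \<longleftrightarrow> (\<exists>A B. A \<union> B = verts G \<and> A \<inter> B = {} \<and>
     (\<forall>e\<in>edges G. \<exists>a\<in>A. \<exists>b\<in>B. e = {a, b}))"

definition vertex_degree :: "'v ugraph \<Rightarrow> 'v \<Rightarrow> nat" where
  "vertex_degree G v = card {e \<in> edges G. v \<in> e}"

definition num_leaf_edges :: "'v ugraph \<Rightarrow> nat" where
  "num_leaf_edges G = card {e \<in> edges G. \<exists>v\<in>e. vertex_degree G v = 1}"

definition num_verts :: "'v ugraph \<Rightarrow> nat" where
  "num_verts G = card (verts G)"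

text \<open>Cycles are subgraphs, not closed walks: the choice of starting point and direction of the
  list of vertices is immaterial.\<close>

definition is_cycle_of :: "'v ugraph \<Rightarrow> 'v ugraph \<Rightarrow> bool" where
  "is_cycle_of C G \<longleftrightarrow> verts C \<subseteq> verts G \<and> edges C \<subseteq> edges G \<and>
     (\<exists>vs. length vs \<ge> 3 \<and> distinct vs \<and> verts C = set vs \<and>
        edges C = {{vs ! i, vs ! (Suc i mod length vs)} | i. i < length vs})"


section \<open>Ideals\<close>

definition ideal_gen :: "'a::comm_ring_1 set \<Rightarrow> 'a set" where
  "ideal_gen S = module.span (*) S"

lemma module_times: "module ((*) :: 'a::comm_ring_1 \<Rightarrow> 'a \<Rightarrow> 'a)"
  by unfold_locales (simp_all add: algebra_simps)

definition ideal_power :: "'a::comm_ring_1 set \<Rightarrow> nat \<Rightarrow> 'a set" where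
  "ideal_power I t = ideal_gen {prod_list fs | fs. length fs = t \<and> set fs \<subseteq> I}"


section \<open>Polynomials and edge ideals\<close>

text \<open>With \<open>'v\<close> finite, this is the polynomial ring over \<open>'k\<close> with one variable
  for each element of \<open>'v\<close>; monomials are identified with their exponent vectors.\<close>

type_synonym ('v, 'k) mpoly = "('v \<Rightarrow>\<^sub>0 nat) \<Rightarrow>\<^sub>0 'k"

definition Var :: "'v \<Rightarrow> ('v, 'k::comm_ring_1) mpoly" where
  "Var i = Poly_Mapping.single (Poly_Mapping.single i 1) 1"

definition max_ideal :: "('v, 'k::comm_ring_1) mpoly set" where
  "max_ideal = ideal_gen (range Var)"

definition edge_ideal :: "'v ugraph \<Rightarrow> ('v, 'k::comm_ring_1) mpoly set" where
  "edge_ideal G = ideal_gen {Var i * Var j | i j. {i, j} \<in> edges G}"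


section \<open>Depth\<close>

text \<open>\<open>regular_seq_quot J fs\<close> says that \<open>fs\<close> is a regular sequence on the module
  \<open>M = R/J\<close>, where \<open>R\<close> is the whole type: every \<open>f\<^sub>i\<close> is a nonzerodivisor on
  \<open>M/(f\<^sub>1, \<dots>, f\<^sub>i\<^sub>-\<^sub>1)M = R/(J + (f\<^sub>1, \<dots>, f\<^sub>i\<^sub>-\<^sub>1))\<close>, and
  \<open>M \<noteq> (f\<^sub>1, \<dots>, f\<^sub>d)M\<close>.\<close>

definition regular_seq_quot :: "'a::comm_ring_1 set \<Rightarrow> 'a list \<Rightarrow> bool" where
  "regular_seq_quot J fs \<longleftrightarrow>
     (\<forall>i<length fs. \<forall>g. fs ! i * g \<in> ideal_gen (J \<union> set (take i fs)) \<longrightarrow>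
        g \<in> ideal_gen (J \<union> set (take i fs))) \<and>
     ideal_gen (J \<union> set fs) \<noteq> UNIV"

text \<open>The depth of \<open>R/J\<close> for a homogeneous ideal \<open>J\<close> is taken with respect to the
  homogeneous maximal ideal.\<close>

definition depth_quot :: "('v, 'k::field) mpoly set \<Rightarrow> enat" where
  "depth_quot J = Sup {enat (length fs) | fs. set fs \<subseteq> max_ideal \<and> regular_seq_quot J fs}"

definition dstab :: "('v, 'k::field) mpoly set \<Rightarrow> nat" where
  "dstab I = (LEAST s. s \<ge> 1 \<and>
     (\<forall>t\<ge>s. depth_quot (ideal_power I t) = depth_quot (ideal_power I s)))"

end

theory Submission
  imports Defs
begin

text \<open>Write \<open>A\<close>, \<open>B\<close> for the two parts of \<open>G\<close>. By the weighted Koenig theorem, \<open>I\<^sup>t\<close> is spanned by the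
  monomials \<open>x\<^sup>\<alpha>\<close> that have weight at least \<open>t\<close> on every vertex cover, so it is the intersection of
  the \<open>t\<close>-th powers of the primes of the minimal covers. Call \<open>\<alpha>\<close> separating for \<open>s\<close> if \<open>A\<close> and \<open>B\<close> both
  have weight \<open>s\<close> and every cover of weight at most \<open>s\<close> contains \<open>A\<close> or \<open>B\<close>. Gluing solutions of
  \<open>h = e\<^sub>1 w\<close> along the minimal covers shows that the elementary symmetric polynomials \<open>e\<^sub>1, e\<^sub>2\<close> form a
  regular sequence on \<open>R/I\<^sup>t\<close> unless some \<open>\<alpha>\<close> is separating for \<open>t - 1\<close>, in which case the depth is 1.

  The least \<open>s\<close> with a separating exponent is then a question about graphs. The indicator functions of
  the disjoint cycles together with those of edges joining the cycles and the non-leaf vertices into a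
  connected graph give a separating \<open>\<alpha>\<close>; a cycle of length \<open>2k\<close> contributes only \<open>k\<close>. Conversely, by
  Koenig a separating \<open>\<alpha>\<close> is the degree vector of a multiset of \<open>s\<close> edges, and the covers obtained by
  exchanging the roles of \<open>A\<close> and \<open>B\<close> across a cut force every non-leaf bridge and at least \<open>k\<close> edges of
  each cycle of length \<open>2k \<ge> 6\<close> into this multiset.\<close>

section \<open>Vertex covers of bipartite graphs\<close>

text \<open>One pair of polynomials has to serve all covers and all fields, whence
  \<open>esym1\<close> and \<open>esym2\<close>. A minimal cover misses two vertices
  \<open>u\<close>, \<open>v\<close>; \<open>esym1\<close> is monic in the variable of
  \<open>u\<close>, and eliminating that variable from \<open>esym2\<close> leaves a quadratic in
  the variable of \<open>v\<close> with leading coefficient -1, in every characteristic. The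
  obstacle is the gluing: solutions at two covers can be compared only if both miss a common vertex.
  A disagreement needs two covers whose union is everything, and this reduces to the pair
  \<open>A\<close>, \<open>B\<close>.

  The number in the theorem comes from a tree count. Drop the leaves, contract each cycle to a point
  and take a spanning tree with edge set \<open>F\<close>: \<open>card F\<close> is the number of
  non-leaf vertices, minus the sum of all \<open>v(C_i) - 1\<close>, minus 1. The separating
  exponent has \<open>s = card F + (v(C_1) + ... + v(C_r)) / 2\<close>, and the depth is 1 from the
  power \<open>s + 1\<close> on. Non-leaf vertices number \<open>v(G)\<close> minus the leaf edges,
  since no edge has two leaves.\<close>

definition vcover :: "'v set set \<Rightarrow> 'v set \<Rightarrow> bool" where
  "vcover E C \<longleftrightarrow> (\<forall>e\<in>E. e \<inter> C \<noteq> {})"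

locale bigraph =
  fixes A B :: "'v::finite set" and E :: "'v set set"
  assumes parts_Un: "A \<union> B = UNIV" and parts_Int: "A \<inter> B = {}"
    and edgeE: "e \<in> E \<Longrightarrow> \<exists>a\<in>A. \<exists>b\<in>B. e = {a, b}"
begin

lemma swap: "bigraph B A E"
proof
  show "\<exists>a\<in>B. \<exists>b\<in>A. e = {a, b}" if "e \<in> E" for e
    using edgeE[OF that] by (metis insert_commute)
qed (use parts_Un parts_Int in auto)

lemma in_B_iff: "v \<in> B \<longleftrightarrow> v \<notin> A"
  using parts_Un parts_Int by auto

lemma edge_neq: "{u, v} \<in> E \<Longrightarrow> u \<in> A \<longleftrightarrow> v \<notin> A"
  using edgeE parts_Int by (fastforce simp: doubleton_eq_iff)

lemma vcover_iff: "vcover E C \<longleftrightarrow> (\<forall>a\<in>A. \<forall>b\<in>B. {a, b} \<in> E \<longrightarrow> a \<in> C \<or> b \<in> C)"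
  unfolding vcover_def using edgeE by fastforce

lemma vcover_parts: "vcover E A" "vcover E B"
  unfolding vcover_iff by auto

text \<open>If \<open>a\<close> is missing from one of the two covers, that cover contains
  \<open>b\<close>. This mix and the one with \<open>A\<close> and \<open>B\<close> exchanged are
  the meet and join of a lattice of covers on which weight is modular, by \<open>sum_mix\<close>;
  this is the uncrossing known from minimum cuts.\<close>

lemma vcover_mix:
  assumes "vcover E C" "vcover E D"
  shows "vcover E (C \<inter> D \<inter> A \<union> (C \<union> D) \<inter> B)"
  using assms unfolding vcover_iff by blast

lemma sum_mix:
  fixes \<alpha> :: "'v \<Rightarrow> nat"
  shows "sum \<alpha> (C \<inter> D \<inter> A \<union> (C \<union> D) \<inter> B) + sum \<alpha> (C \<inter> D \<inter> B \<union> (C \<union> D) \<inter> A) = sum \<alpha> C + sum \<alpha> D"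
proof -
  let ?X = "C \<inter> D \<inter> A \<union> (C \<union> D) \<inter> B" and ?Y = "C \<inter> D \<inter> B \<union> (C \<union> D) \<inter> A"
  have "?X \<union> ?Y = C \<union> D" "?X \<inter> ?Y = C \<inter> D"
    using parts_Un parts_Int by auto
  then show ?thesis
    using sum.union_inter[of ?X ?Y \<alpha>] sum.union_inter[of C D \<alpha>] by simp
qed

text \<open>Tight covers are closed under \<open>vcover_mix\<close>; a tight cover of positive weight on \<open>A\<close> with the
  fewest vertices in \<open>A\<close> supplies the edge.\<close>

lemma edge_avoiding_tight_covers:
  fixes \<alpha> :: "'v \<Rightarrow> nat"
  assumes min: "\<And>C. vcover E C \<Longrightarrow> s \<le> sum \<alpha> C"
    and D0: "vcover E D0" "sum \<alpha> D0 = s" "sum \<alpha> (D0 \<inter> A) > 0"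
  shows "\<exists>a\<in>A. \<exists>b\<in>B. {a, b} \<in> E \<and> \<alpha> a > 0 \<and> \<alpha> b > 0 \<and>
    (\<forall>C. vcover E C \<and> sum \<alpha> C = s \<longrightarrow> \<not> (a \<in> C \<and> b \<in> C))"
proof -
  define P where "P D \<longleftrightarrow> vcover E D \<and> sum \<alpha> D = s \<and> sum \<alpha> (D \<inter> A) > 0" for D
  obtain D where D: "P D" and Dmin: "\<And>D'. P D' \<Longrightarrow> card (D \<inter> A) \<le> card (D' \<inter> A)"
    using ex_has_least_nat[of P D0 "\<lambda>D. card (D \<inter> A)"] D0 unfolding P_def by auto
  then obtain a where a: "a \<in> D" "a \<in> A" "\<alpha> a > 0"
    unfolding P_def by (metis Int_iff gr0I less_numeral_extra(3) sum.neutral)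
  have "\<exists>b. {a, b} \<in> E \<and> b \<notin> D \<and> \<alpha> b > 0"
  proof (rule ccontr)
    assume H: "\<not> ?thesis"
    \<comment> \<open>Replacing \<open>a\<close> by its neighbours outside \<open>D\<close> gives
      another cover; if these all had weight 0, it would be lighter than \<open>s\<close>.\<close>
    define N where "N = {b \<in> B. {a, b} \<in> E \<and> b \<notin> D}"
    have "vcover E (D - {a} \<union> N)"
      using D a(2) parts_Int unfolding vcover_iff N_def P_def by auto
    then have "s \<le> sum \<alpha> (D - {a} \<union> N)" by (rule min)
    also have "\<dots> = sum \<alpha> (D - {a}) + sum \<alpha> N"
      by (rule sum.union_disjoint) (auto simp: N_def)
    also have "sum \<alpha> N = 0" using H unfolding N_def by auto
    also have "sum \<alpha> (D - {a}) = sum \<alpha> D - \<alpha> a"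
      using a by (simp add: sum_diff1_nat)
    finally have "s \<le> sum \<alpha> D - \<alpha> a" by simp
    moreover have "\<alpha> a \<le> sum \<alpha> D" using a by (simp add: member_le_sum)
    ultimately show False using a D unfolding P_def by simp
  qed
  then obtain b where b: "{a, b} \<in> E" "b \<notin> D" "\<alpha> b > 0" by auto
  have bB: "b \<in> B" using edgeE[OF b(1)] a(2) parts_Int by (auto simp: doubleton_eq_iff)
  have "\<not> (a \<in> C \<and> b \<in> C)" if C: "vcover E C" "sum \<alpha> C = s" for C
  proof
    assume ab: "a \<in> C \<and> b \<in> C"
    \<comment> \<open>Uncross \<open>C\<close> with \<open>D\<close>: both mixes are covers, so both
      are tight. By the choice of \<open>D\<close> the first one keeps all of
      \<open>D \<inter> A\<close>; as it also gains \<open>b\<close>, it weighs more than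
      \<open>D\<close>.\<close>
    let ?X = "C \<inter> D \<inter> A \<union> (C \<union> D) \<inter> B" and ?Y = "C \<inter> D \<inter> B \<union> (C \<union> D) \<inter> A"
    have cov: "vcover E ?X" "vcover E ?Y"
      using vcover_mix bigraph.vcover_mix[OF swap] C D unfolding P_def by auto
    then have "s \<le> sum \<alpha> ?X" "s \<le> sum \<alpha> ?Y" using min by auto
    then have "sum \<alpha> ?X = s" using sum_mix[of \<alpha> C D] C D unfolding P_def by linarith
    moreover have "sum \<alpha> (?X \<inter> A) > 0"
    proof -
      have "\<alpha> a \<le> sum \<alpha> (?X \<inter> A)" using a ab by (intro member_le_sum) auto
      then show ?thesis using a by linarith
    qed
    ultimately have "card (D \<inter> A) \<le> card (?X \<inter> A)" using Dmin cov unfolding P_def by auto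
    moreover have "?X \<inter> A \<subseteq> D \<inter> A" using parts_Int by auto
    ultimately have "?X \<inter> A = D \<inter> A" by (meson card_seteq finite)
    then have "insert b D \<subseteq> ?X" using a ab bB parts_Un by auto
    then have "sum \<alpha> (insert b D) \<le> sum \<alpha> ?X" by (intro sum_mono2) auto
    then show False using \<open>sum \<alpha> ?X = s\<close> b D unfolding P_def by simp
  qed
  then show ?thesis using a b bB by blast
qed

text \<open>The bound says that \<open>\<alpha>\<close> minus the edge still weighs at least
  \<open>s\<close> on every cover. Only a cover of weight exactly \<open>Suc s\<close> that contains
  both ends could violate it.\<close>

lemma edge_with_vcover_bound:
  fixes \<alpha> :: "'v \<Rightarrow> nat"
  assumes min: "\<And>C. vcover E C \<Longrightarrow> Suc s \<le> sum \<alpha> C"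
  shows "\<exists>a\<in>A. \<exists>b\<in>B. {a, b} \<in> E \<and> \<alpha> a > 0 \<and> \<alpha> b > 0 \<and>
    (\<forall>C. vcover E C \<longrightarrow> s + of_bool (a \<in> C) + of_bool (b \<in> C) \<le> sum \<alpha> C)"
proof (cases "\<exists>D. vcover E D \<and> sum \<alpha> D = Suc s")
  case True
  then obtain D where D: "vcover E D" "sum \<alpha> D = Suc s" by auto
  have "D = (D \<inter> A) \<union> (D \<inter> B)" using parts_Un by auto
  then have "sum \<alpha> D = sum \<alpha> (D \<inter> A) + sum \<alpha> (D \<inter> B)"
    using sum.union_disjoint[of "D \<inter> A" "D \<inter> B" \<alpha>] parts_Int by auto
  then consider "sum \<alpha> (D \<inter> A) > 0" | "sum \<alpha> (D \<inter> B) > 0" using D by linarith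
  then have "\<exists>a\<in>A. \<exists>b\<in>B. {a, b} \<in> E \<and> \<alpha> a > 0 \<and> \<alpha> b > 0 \<and>
    (\<forall>C. vcover E C \<and> sum \<alpha> C = Suc s \<longrightarrow> \<not> (a \<in> C \<and> b \<in> C))"
  proof cases
    case 1
    then show ?thesis using edge_avoiding_tight_covers[OF min D] by blast
  next
    case 2
    then obtain b a where "b \<in> B" "a \<in> A" "{b, a} \<in> E" "\<alpha> b > 0" "\<alpha> a > 0"
      "\<forall>C. vcover E C \<and> sum \<alpha> C = Suc s \<longrightarrow> \<not> (b \<in> C \<and> a \<in> C)"
      using bigraph.edge_avoiding_tight_covers[OF swap min D] by blast
    then show ?thesis by (intro bexI[of _ a] bexI[of _ b]) (auto simp: insert_commute)
  qed
  then obtain a b where ab: "a \<in> A" "b \<in> B" "{a, b} \<in> E" "\<alpha> a > 0" "\<alpha> b > 0"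
    and nt: "\<And>C. vcover E C \<Longrightarrow> sum \<alpha> C = Suc s \<Longrightarrow> \<not> (a \<in> C \<and> b \<in> C)" by blast
  have "s + of_bool (a \<in> C) + of_bool (b \<in> C) \<le> sum \<alpha> C" if "vcover E C" for C
    using min[OF that] nt[OF that] by (cases "sum \<alpha> C = Suc s") (auto simp: of_bool_def)
  then show ?thesis using ab by blast
next
  case False
  \<comment> \<open>No cover is tight, so any edge of positive weight at both ends will do; it
    exists because the zero set of \<open>\<alpha>\<close> is too light to be a cover.\<close>
  have "\<not> vcover E {v. \<alpha> v = 0}" using min[of "{v. \<alpha> v = 0}"] by auto
  then obtain a b where ab: "a \<in> A" "b \<in> B" "{a, b} \<in> E" "\<alpha> a > 0" "\<alpha> b > 0"
    unfolding vcover_iff by auto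
  have "s + of_bool (a \<in> C) + of_bool (b \<in> C) \<le> sum \<alpha> C" if "vcover E C" for C
    using min[OF that] False that by (cases "sum \<alpha> C = Suc s") (auto simp: of_bool_def)
  then show ?thesis using ab by blast
qed

text \<open>Min-max theorem with vertex capacities \<open>\<alpha>\<close>, by removing one edge at
  a time. Edges may repeat, hence a list; it encodes a product of \<open>s\<close> edge monomials
  dividing the monomial of exponent \<open>\<alpha>\<close>.\<close>

theorem weighted_konig:
  fixes \<alpha> :: "'v \<Rightarrow> nat"
  assumes "\<And>C. vcover E C \<Longrightarrow> s \<le> sum \<alpha> C"
  shows "\<exists>es. length es = s \<and> set es \<subseteq> E \<and> (\<forall>v. (\<Sum>e\<leftarrow>es. of_bool (v \<in> e)) \<le> \<alpha> v)"
  using assms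
proof (induction s arbitrary: \<alpha>)
  case 0
  show ?case by (intro exI[of _ "[]"]) simp
next
  case (Suc s)
  obtain a b where ab: "a \<in> A" "b \<in> B" "{a, b} \<in> E" "\<alpha> a > 0" "\<alpha> b > 0"
    and bd: "\<And>C. vcover E C \<Longrightarrow> s + of_bool (a \<in> C) + of_bool (b \<in> C) \<le> sum \<alpha> C"
    using edge_with_vcover_bound[OF Suc.prems] by blast
  have neq: "a \<noteq> b" using ab parts_Int by auto
  define \<beta> where "\<beta> v = \<alpha> v - of_bool (v \<in> {a, b})" for v
  have \<alpha>: "\<alpha> v = \<beta> v + (of_bool (v = a) + of_bool (v = b))" for v
    using ab neq by (auto simp: \<beta>_def)
  have "s \<le> sum \<beta> C" if "vcover E C" for C
  proof -
    have "sum \<alpha> C = sum \<beta> C + (of_bool (a \<in> C) + of_bool (b \<in> C))"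
      unfolding \<alpha> sum.distrib by (simp add: of_bool_def)
    then show ?thesis using bd[OF that] by simp
  qed
  then obtain es where es: "length es = s" "set es \<subseteq> E"
    "\<And>v. (\<Sum>e\<leftarrow>es. of_bool (v \<in> e)) \<le> \<beta> v"
    using Suc.IH by blast
  show ?case
  proof (intro exI[of _ "{a, b} # es"] conjI allI)
    fix v
    show "(\<Sum>e\<leftarrow>{a, b} # es. of_bool (v \<in> e)) \<le> \<alpha> v"
      using es(3)[of v] neq unfolding \<alpha>[of v] by auto
  qed (use es ab in auto)
qed

lemma sum_edge_degrees:
  fixes C :: "'v set"
  shows "(\<Sum>v\<in>C. \<Sum>e\<leftarrow>es. of_bool (v \<in> e)) = (\<Sum>e\<leftarrow>es. card (e \<inter> C))"
proof (induction es)
  case (Cons e es)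
  have "(\<Sum>v\<in>C. of_bool (v \<in> e)) = card (e \<inter> C)"
    by (simp add: Int_commute Collect_conj_eq flip: Int_def)
  then show ?case using Cons by (simp add: sum.distrib)
qed simp

end

section \<open>Monomial ideals\<close>

abbreviation "lookup \<equiv> Poly_Mapping.lookup"
abbreviation "keys \<equiv> Poly_Mapping.keys"

definition wt :: "('v \<Rightarrow>\<^sub>0 nat) \<Rightarrow> 'v set \<Rightarrow> nat" where
  "wt m C = sum (lookup m) C"

lemma wt_add: "wt (m + n) C = wt m C + wt n C"
  by (simp add: wt_def lookup_add sum.distrib)

lemma wt_zero [simp]: "wt 0 C = 0"
  by (simp add: wt_def)

lemma wt_single: "wt (Poly_Mapping.single (v :: 'v::finite) n) C = (if v \<in> C then n else 0)"
  by (simp add: wt_def lookup_single when_def)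

lemma wt_mono: "C \<subseteq> D \<Longrightarrow> wt m C \<le> wt m (D :: 'v::finite set)"
  unfolding wt_def by (rule sum_mono2) auto

text \<open>The span of the monomials with exponents in \<open>S\<close>. It is an ideal for
  \<open>upclosed\<close> sets; with other sets it also expresses freeness of a variable or a degree
  bound.\<close>

definition monomial_ideal :: "('v \<Rightarrow>\<^sub>0 nat) set \<Rightarrow> ('v, 'k::comm_ring_1) mpoly set" where
  "monomial_ideal S = {p. keys p \<subseteq> S}"

lemma monomial_ideal_iff: "p \<in> monomial_ideal S \<longleftrightarrow> (\<forall>m. m \<notin> S \<longrightarrow> lookup p m = 0)"
  unfolding monomial_ideal_def by (auto simp: in_keys_iff)

lemma monomial_ideal_zero [simp]: "0 \<in> monomial_ideal S"
  by (simp add: monomial_ideal_iff)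

lemma monomial_ideal_add:
  "p \<in> monomial_ideal S \<Longrightarrow> q \<in> monomial_ideal S \<Longrightarrow> p + q \<in> monomial_ideal S"
  by (simp add: monomial_ideal_iff lookup_add)

lemma monomial_ideal_diff:
  "p \<in> monomial_ideal S \<Longrightarrow> q \<in> monomial_ideal S \<Longrightarrow> p - q \<in> monomial_ideal S"
  by (simp add: monomial_ideal_iff lookup_minus)

lemma monomial_ideal_sum:
  "(\<And>i. i \<in> X \<Longrightarrow> f i \<in> monomial_ideal S) \<Longrightarrow> sum f X \<in> monomial_ideal S"
  by (simp add: monomial_ideal_iff lookup_sum)

definition upclosed :: "('v \<Rightarrow>\<^sub>0 nat) set \<Rightarrow> bool" where
  "upclosed S \<longleftrightarrow> (\<forall>m n. m \<in> S \<longrightarrow> n + m \<in> S)"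

lemma monomial_ideal_mult_mono:
  assumes "p \<in> monomial_ideal S" "q \<in> monomial_ideal T"
    and "\<And>m n. m \<in> S \<Longrightarrow> n \<in> T \<Longrightarrow> m + n \<in> U"
  shows "p * q \<in> monomial_ideal U"
  using assms keys_mult[of p q] unfolding monomial_ideal_def by blast

lemma monomial_ideal_mult:
  "upclosed S \<Longrightarrow> q \<in> monomial_ideal S \<Longrightarrow> p * q \<in> monomial_ideal S"
  by (rule monomial_ideal_mult_mono[where S = UNIV and T = S])
    (auto simp: monomial_ideal_def upclosed_def)

lemma monomial_ideal_single [simp]:
  "Poly_Mapping.single m c \<in> monomial_ideal S \<longleftrightarrow> c = 0 \<or> m \<in> S"
  by (simp add: monomial_ideal_def)

lemma upclosed_wt: "upclosed {m. t \<le> wt m C}"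
  by (simp add: upclosed_def wt_add)

text \<open>The variable of a vertex outside \<open>C\<close> does not change the weight on
  \<open>C\<close>, so it is a nonzerodivisor modulo the component of \<open>C\<close>.\<close>

lemma wt_not_le_single:
  fixes u :: "'v::finite"
  assumes "u \<notin> C" shows "m \<notin> {m. t \<le> wt m C} \<Longrightarrow> Poly_Mapping.single u 1 + m \<notin> {m. t \<le> wt m C}"
  using assms by (simp add: wt_add wt_single)

lemma upclosed_Un: "upclosed S \<Longrightarrow> upclosed T \<Longrightarrow> upclosed (S \<union> T)"
  by (auto simp: upclosed_def)

lemma Var_mem_monomial_ideal [simp]:
  "Var v \<in> monomial_ideal S \<longleftrightarrow> Poly_Mapping.single v 1 \<in> S"
  by (simp add: Var_def)

lemma poly_mapping_sum_single:
  "p = (\<Sum>m\<in>keys p. Poly_Mapping.single m (lookup p m))"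
proof (rule poly_mapping_eqI)
  fix k
  show "lookup p k = lookup (\<Sum>m\<in>keys p. Poly_Mapping.single m (lookup p m)) k"
    by (cases "k \<in> keys p") (auto simp: lookup_sum lookup_single when_def in_keys_iff)
qed

text \<open>A polynomial whose only term of degree at least \<open>d\<close> in the variable \<open>u\<close> is a multiple of
  \<open>u\<^sup>d\<close> behaves like a monic polynomial in \<open>u\<close>: the exponent \<open>m \<notin> S\<close> of \<open>w\<close> of maximal degree
  in \<open>u\<close> cannot be cancelled in degree \<open>m + d u\<close> of the product.\<close>

lemma monic_mult_mem_monomial_idealD:
  fixes p w :: "('v, 'k::field) mpoly"
  assumes S: "upclosed S"
    and u: "\<And>m. m \<notin> S \<Longrightarrow> Poly_Mapping.single u d + m \<notin> S"
    and c: "lookup p (Poly_Mapping.single u d) \<noteq> 0"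
    and p: "\<And>n. n \<in> keys p \<Longrightarrow> n \<noteq> Poly_Mapping.single u d \<Longrightarrow> lookup n u < d"
    and pw: "\<And>m. m \<notin> S \<Longrightarrow> d \<le> lookup m u \<Longrightarrow> lookup (p * w) m = 0"
  shows "w \<in> monomial_ideal S"
proof (rule ccontr)
  let ?x = "Poly_Mapping.single u d"
  assume "w \<notin> monomial_ideal S"
  then have ne: "keys w - S \<noteq> {}" unfolding monomial_ideal_def by auto
  let ?D = "(\<lambda>m. lookup m u) ` (keys w - S)"
  have "Max ?D \<in> ?D" by (rule Max_in) (use ne in auto)
  then obtain m where m: "m \<in> keys w - S" "lookup m u = Max ?D" by auto
  have mmax: "lookup m' u \<le> lookup m u" if "m' \<in> keys w - S" for m'
    unfolding m(2) by (rule Max_ge) (use that in auto)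
  have notS: "?x + m \<notin> S" using u m by auto
  define p' where "p' = p - Poly_Mapping.single ?x (lookup p ?x)"
  define w' where "w' = w - Poly_Mapping.single m (lookup w m)"
  have keys_p': "a \<in> keys p" "a \<noteq> ?x" if "a \<in> keys p'" for a
    using that unfolding p'_def in_keys_iff lookup_minus lookup_single when_def by (auto split: if_splits)
  have keys_w': "a \<in> keys w" "a \<noteq> m" if "a \<in> keys w'" for a
    using that unfolding w'_def in_keys_iff lookup_minus lookup_single when_def by (auto split: if_splits)
  \<comment> \<open>An exponent dividing one outside the upclosed \<open>S\<close> is itself outside
    \<open>S\<close>, so the maximality of \<open>m\<close> controls every contributing
    \<open>b\<close>.\<close>
  have low: "b \<notin> S" if "a + b = ?x + m" for a b
    using that S notS unfolding upclosed_def by metis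
  have "lookup (p' * w) (?x + m) = 0"
  proof (rule ccontr)
    assume "lookup (p' * w) (?x + m) \<noteq> 0"
    then obtain a b where ab: "a \<in> keys p'" "b \<in> keys w" "a + b = ?x + m"
      using keys_mult[of p' w] by (auto simp: in_keys_iff)
    then have "lookup a u < d" using keys_p' p by blast
    moreover have "lookup b u \<le> lookup m u" using mmax ab low by blast
    moreover have "lookup a u + lookup b u = d + lookup m u"
      using ab(3) by (metis lookup_add lookup_single_eq)
    ultimately show False by linarith
  qed
  moreover have "lookup (Poly_Mapping.single ?x (lookup p ?x) * w') (?x + m) = 0"
  proof (rule ccontr)
    assume "lookup (Poly_Mapping.single ?x (lookup p ?x) * w') (?x + m) \<noteq> 0"
    then obtain b where "b \<in> keys w'" "?x + b = ?x + m"
      using keys_mult[of "Poly_Mapping.single ?x (lookup p ?x)" w'] by (auto simp: in_keys_iff lookup_single when_def split: if_splits)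
    then show False using keys_w' by auto
  qed
  moreover have "p * w = p' * w + (Poly_Mapping.single ?x (lookup p ?x) * w'
      + Poly_Mapping.single (?x + m) (lookup p ?x * lookup w m))"
    unfolding p'_def w'_def by (simp add: algebra_simps mult_single)
  ultimately have "lookup (p * w) (?x + m) = lookup p ?x * lookup w m"
    by (simp add: lookup_add)
  moreover have "lookup w m \<noteq> 0" using m(1) by (simp add: in_keys_iff)
  moreover have "d \<le> lookup (?x + m) u" by (simp add: lookup_add)
  ultimately show False using c pw[OF notS] by auto
qed

section \<open>Generated ideals\<close>

lemma ideal_gen_base: "x \<in> S \<Longrightarrow> x \<in> ideal_gen S"
  unfolding ideal_gen_def by (rule module.span_base[OF module_times])

lemma ideal_gen_mult: "x \<in> ideal_gen S \<Longrightarrow> c * x \<in> ideal_gen S"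
  unfolding ideal_gen_def by (rule module.span_scale[OF module_times])

lemma ideal_gen_sum: "(\<And>i. i \<in> X \<Longrightarrow> f i \<in> ideal_gen S) \<Longrightarrow> sum f X \<in> ideal_gen S"
  unfolding ideal_gen_def by (rule module.span_sum[OF module_times])

lemma ideal_gen_subset_monomial_ideal:
  assumes "upclosed U" and "S \<subseteq> monomial_ideal U"
  shows "ideal_gen S \<subseteq> monomial_ideal U"
  unfolding ideal_gen_def
proof (rule module.span_minimal[OF module_times assms(2)])
  show "module.subspace (*) (monomial_ideal U)"
    using assms(1) by (auto simp: module.subspace_def[OF module_times] intro: monomial_ideal_add monomial_ideal_mult)
qed

lemma ideal_gen_Un_insert:
  assumes "ideal_gen J = J"
  shows "p \<in> ideal_gen (J \<union> {f}) \<longleftrightarrow> (\<exists>w. p - f * w \<in> J)"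
  using assms module.span_breakdown_eq[OF module_times, of p f J]
  by (simp add: ideal_gen_def mult.commute)

lemma max_ideal_subset:
  "max_ideal \<subseteq> (monomial_ideal (- {0}) :: ('v, 'k::field) mpoly set)"
  unfolding max_ideal_def
  by (rule ideal_gen_subset_monomial_ideal)
    (auto simp: upclosed_def poly_mapping_eq_iff lookup_add fun_eq_iff lookup_single when_def)

section \<open>Powers of the edge ideal of a bipartite graph\<close>

context bigraph
begin

definition cover_exps :: "nat \<Rightarrow> ('v \<Rightarrow>\<^sub>0 nat) set" where
  "cover_exps t = {m. \<forall>C. vcover E C \<longrightarrow> t \<le> wt m C}"

lemma upclosed_cover_exps: "upclosed (cover_exps t)"
  by (simp add: upclosed_def cover_exps_def wt_add trans_le_add2)

lemma edge_ideal_subset: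
  assumes "edges G = E"
  shows "(edge_ideal G :: ('v, 'k::field) mpoly set) \<subseteq> monomial_ideal (cover_exps 1)"
  unfolding edge_ideal_def
proof (rule ideal_gen_subset_monomial_ideal[OF upclosed_cover_exps], safe)
  fix i j assume "{i, j} \<in> edges G"
  then have "{i, j} \<in> E" using assms by simp
  have "1 \<le> wt (Poly_Mapping.single i 1 + Poly_Mapping.single j 1) C" if "vcover E C" for C
  proof -
    have "{i, j} \<inter> C \<noteq> {}" using \<open>{i, j} \<in> E\<close> that unfolding vcover_def by (rule bspec[rotated])
    then show ?thesis by (auto simp: wt_add wt_single)
  qed
  then have "Poly_Mapping.single i 1 + Poly_Mapping.single j 1 \<in> cover_exps 1"
    unfolding cover_exps_def by simp
  then show "(Var i * Var j :: ('v, 'k) mpoly) \<in> monomial_ideal (cover_exps 1)"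
    by (simp add: Var_def mult_single)
qed

lemma prod_list_mem_cover_exps:
  assumes "set fs \<subseteq> (monomial_ideal (cover_exps 1) :: ('v, 'k::field) mpoly set)"
  shows "prod_list fs \<in> monomial_ideal (cover_exps (length fs))"
  using assms
proof (induction fs)
  case Nil
  then show ?case by (simp add: cover_exps_def monomial_ideal_def)
next
  case (Cons f fs)
  have "m + n \<in> cover_exps (Suc (length fs))"
    if "m \<in> cover_exps 1" "n \<in> cover_exps (length fs)" for m n
    unfolding cover_exps_def mem_Collect_eq
  proof (intro allI impI)
    fix C assume "vcover E C"
    then have "1 \<le> wt m C" "length fs \<le> wt n C" using that unfolding cover_exps_def by auto
    then show "Suc (length fs) \<le> wt (m + n) C" by (simp add: wt_add)
  qed
  then have "f * prod_list fs \<in> monomial_ideal (cover_exps (Suc (length fs)))"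
    using Cons by (intro monomial_ideal_mult_mono[where S = "cover_exps 1" and T = "cover_exps (length fs)"]) auto
  then show ?case by simp
qed

theorem ideal_power_edge_ideal:
  assumes G: "edges G = E"
  shows "(ideal_power (edge_ideal G) t :: ('v, 'k::field) mpoly set) = monomial_ideal (cover_exps t)"
proof
  show "(ideal_power (edge_ideal G) t :: ('v, 'k) mpoly set) \<subseteq> monomial_ideal (cover_exps t)"
    unfolding ideal_power_def
    by (rule ideal_gen_subset_monomial_ideal[OF upclosed_cover_exps])
      (use prod_list_mem_cover_exps edge_ideal_subset[OF G] in blast)
next
  have single: "(Poly_Mapping.single m c :: ('v, 'k) mpoly) \<in> ideal_power (edge_ideal G) t"
    if m: "m \<in> cover_exps t" for m c
  proof -
    obtain es where es: "length es = t" "set es \<subseteq> E"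
      "\<And>v. (\<Sum>e\<leftarrow>es. of_bool (v \<in> e)) \<le> lookup m v"
      using weighted_konig[of t "lookup m"] m unfolding cover_exps_def wt_def by auto
    define mon :: "'v set \<Rightarrow> 'v \<Rightarrow>\<^sub>0 nat" where "mon e = (\<Sum>i\<in>e. Poly_Mapping.single i 1)" for e
    define fs :: "('v, 'k) mpoly list" where "fs = map (\<lambda>e. Poly_Mapping.single (mon e) 1) es"
    have "set fs \<subseteq> edge_ideal G"
    proof
      fix f assume "f \<in> set fs"
      then obtain e where e: "e \<in> E" "f = Poly_Mapping.single (mon e) 1"
        using es(2) unfolding fs_def by auto
      obtain a b where ab: "a \<in> A" "b \<in> B" "e = {a, b}" using edgeE[OF e(1)] by auto
      then have "a \<noteq> b" using parts_Int by auto
      then have "f = Var a * Var b"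
        using ab e by (simp add: mon_def Var_def mult_single)
      then show "f \<in> edge_ideal G"
        unfolding edge_ideal_def using ab e G by (intro ideal_gen_base) auto
    qed
    moreover have "length fs = t" using es(1) by (simp add: fs_def)
    ultimately have fs: "prod_list fs \<in> ideal_power (edge_ideal G) t"
      using \<open>set fs \<subseteq> edge_ideal G\<close> unfolding ideal_power_def
      by (intro ideal_gen_base CollectI exI[of _ fs]) simp
    have prod: "prod_list fs = Poly_Mapping.single (\<Sum>e\<leftarrow>es. mon e) 1"
      unfolding fs_def by (induction es) (simp_all add: mult_single)
    have "lookup (mon e) v = of_bool (v \<in> e)" for e v
      by (simp add: mon_def lookup_sum lookup_single when_def)
    then have lk: "lookup (\<Sum>e\<leftarrow>es. mon e) v = (\<Sum>e\<leftarrow>es. of_bool (v \<in> e))" for v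
      by (induction es) (simp_all add: lookup_add)
    have "m = (m - (\<Sum>e\<leftarrow>es. mon e)) + (\<Sum>e\<leftarrow>es. mon e)"
      by (rule poly_mapping_eqI) (use es(3) in \<open>simp add: lookup_add lookup_minus lk\<close>)
    then have "Poly_Mapping.single m c = Poly_Mapping.single (m - (\<Sum>e\<leftarrow>es. mon e)) c * prod_list fs"
      unfolding prod by (simp add: mult_single)
    then show ?thesis using fs unfolding ideal_power_def by (simp add: ideal_gen_mult)
  qed
  show "monomial_ideal (cover_exps t) \<subseteq> (ideal_power (edge_ideal G) t :: ('v, 'k) mpoly set)"
  proof
    fix p :: "('v, 'k) mpoly" assume "p \<in> monomial_ideal (cover_exps t)"
    then have "keys p \<subseteq> cover_exps t" by (simp add: monomial_ideal_def)
    then have "(\<Sum>m\<in>keys p. Poly_Mapping.single m (lookup p m)) \<in> ideal_power (edge_ideal G) t"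
      using single unfolding ideal_power_def by (intro ideal_gen_sum) auto
    then show "p \<in> ideal_power (edge_ideal G) t"
      using poly_mapping_sum_single[of p] by simp
  qed
qed

end

section \<open>The first two elementary symmetric polynomials as a regular sequence\<close>

definition esym1 :: "'v set \<Rightarrow> ('v, 'k::comm_ring_1) mpoly" where
  "esym1 W = (\<Sum>i\<in>W. Var i)"

definition esym2 :: "'v set \<Rightarrow> ('v, 'k::comm_ring_1) mpoly" where
  "esym2 W = (\<Sum>e | e \<subseteq> W \<and> card e = 2. \<Prod>i\<in>e. Var i)"

lemma esym1_insert: "finite W \<Longrightarrow> u \<notin> W \<Longrightarrow> esym1 (insert u W) = Var u + esym1 W"
  by (simp add: esym1_def)

lemma esym2_insert:
  assumes "finite W" "u \<notin> W"
  shows "esym2 (insert u W) = esym2 W + Var u * esym1 W"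
proof -
  have "{e. e \<subseteq> insert u W \<and> card e = 2} = {e. e \<subseteq> W \<and> card e = 2} \<union> (\<lambda>j. {u, j}) ` W" (is "?L = ?R1 \<union> ?R2")
  proof
    show "?L \<subseteq> ?R1 \<union> ?R2"
    proof
      fix e assume "e \<in> ?L"
      then obtain x y where "e = {x, y}" "x \<noteq> y" "{x, y} \<subseteq> insert u W"
        by (auto simp: card_2_iff)
      then show "e \<in> ?R1 \<union> ?R2"
        by (cases "x = u"; cases "y = u") (auto simp: insert_commute)
    qed
    show "?R1 \<union> ?R2 \<subseteq> ?L" using assms by (auto simp: card_2_iff)
  qed
  moreover have "?R1 \<inter> ?R2 = {}" using assms by auto
  moreover have "finite ?R1" "finite ?R2" using assms by (auto intro: finite_subset[of _ "Pow W"])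
  ultimately have "(esym2 (insert u W) :: ('a, 'b) mpoly) = esym2 W + (\<Sum>e\<in>?R2. \<Prod>i\<in>e. Var i)"
    unfolding esym2_def by (simp add: sum.union_disjoint)
  also have "(\<Sum>e\<in>?R2. \<Prod>i\<in>e. Var i) = (\<Sum>j\<in>W. \<Prod>i\<in>{u, j}. Var i :: ('a, 'b) mpoly)"
    by (subst sum.reindex) (use assms in \<open>auto simp: inj_on_def doubleton_eq_iff\<close>)
  also have "\<dots> = (\<Sum>j\<in>W. Var u * Var j)"
    using assms by (intro sum.cong) (auto simp: prod.insert_if)
  finally show ?thesis by (simp add: esym1_def sum_distrib_left)
qed

lemma esym1_mem_max_ideal: "esym1 W \<in> max_ideal"
  unfolding esym1_def max_ideal_def by (intro ideal_gen_sum ideal_gen_base) simp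

lemma esym2_mem_max_ideal: "esym2 W \<in> max_ideal"
  unfolding esym2_def max_ideal_def
proof (intro ideal_gen_sum)
  fix e :: "'a set" assume "e \<in> {e. e \<subseteq> W \<and> card e = 2}"
  then obtain x y where "e = {x, y}" "x \<noteq> y" by (auto simp: card_2_iff)
  then have "(\<Prod>i\<in>e. Var i) = Var x * (Var y :: ('a, 'b) mpoly)" by simp
  moreover have "Var x * (Var y :: ('a, 'b) mpoly) \<in> ideal_gen (range Var)"
    by (intro ideal_gen_mult ideal_gen_base) simp
  ultimately show "(\<Prod>i\<in>e. Var i) \<in> (ideal_gen (range Var) :: ('a, 'b) mpoly set)" by simp
qed

lemma Var_mem_degree: "Var i \<in> monomial_ideal {n. lookup n u \<le> of_bool (i = u)}"
  by (simp add: lookup_single when_def)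

lemma esym1_mem_degree: "u \<notin> W \<Longrightarrow> esym1 W \<in> monomial_ideal {n. lookup n u = 0}"
  unfolding esym1_def by (rule monomial_ideal_sum) (auto simp: lookup_single when_def)

lemma mult_mem_degree:
  assumes "p \<in> monomial_ideal {n. lookup n u \<le> c}" "q \<in> monomial_ideal {n. lookup n u \<le> d}"
  shows "p * q \<in> monomial_ideal {n. lookup n u \<le> c + d}"
  by (rule monomial_ideal_mult_mono[OF assms]) (auto simp: lookup_add)

lemma esym2_mem_degree:
  assumes "finite W" "u \<notin> W"
  shows "(esym2 W :: ('v, 'k::comm_ring_1) mpoly) \<in> monomial_ideal {n. lookup n u \<le> 0}"
  using assms
proof (induction W rule: finite_induct)
  case empty
  have "{e :: 'v set. e \<subseteq> {} \<and> card e = 2} = {}" by auto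
  then show ?case by (simp only: esym2_def sum.empty monomial_ideal_zero)
next
  case (insert x W)
  have "(Var x * esym1 W :: ('v, 'k) mpoly) \<in> monomial_ideal {n. lookup n u \<le> 0 + 0}"
    using Var_mem_degree[of x u] esym1_mem_degree[of u W] insert.prems by (intro mult_mem_degree) auto
  then show ?case using insert by (simp add: esym2_insert monomial_ideal_add)
qed

lemma single_Suc_0_eq_iff:
  "Poly_Mapping.single x (Suc 0) = Poly_Mapping.single y (Suc 0) \<longleftrightarrow> x = y"
  by (metis lookup_single_eq lookup_single_not_eq nat.distinct(1))

text \<open>\<open>esym1 UNIV\<close> is monic of degree 1 in every variable, so it is regular at a
  cover whichever vertex \<open>u\<close> the cover misses.\<close>

lemma esym1_mult_mem_monomial_idealD:
  fixes w :: "('v::finite, 'k::field) mpoly"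
  assumes "upclosed S" "\<And>m. m \<notin> S \<Longrightarrow> Poly_Mapping.single u 1 + m \<notin> S"
    and "\<And>m. m \<notin> S \<Longrightarrow> 1 \<le> lookup m u \<Longrightarrow> lookup (esym1 UNIV * w) m = 0"
  shows "w \<in> monomial_ideal S"
proof (rule monic_mult_mem_monomial_idealD[OF assms(1,2) _ _ assms(3)])
  show "lookup (esym1 UNIV :: ('v, 'k) mpoly) (Poly_Mapping.single u 1) \<noteq> 0"
    by (simp add: esym1_def Var_def lookup_sum lookup_single when_def single_Suc_0_eq_iff)
  show "lookup n u < 1" if "n \<in> keys (esym1 UNIV :: ('v, 'k) mpoly)" "n \<noteq> Poly_Mapping.single u 1" for n
  proof -
    have "(\<Sum>i\<in>UNIV. lookup (Var i :: ('v, 'k) mpoly) n) \<noteq> 0"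
      using that(1) by (simp add: in_keys_iff esym1_def lookup_sum)
    then obtain i where "lookup (Var i :: ('v, 'k) mpoly) n \<noteq> 0"
      by (rule sum.not_neutral_contains_not_neutral)
    then have "n = Poly_Mapping.single i 1"
      by (simp add: Var_def lookup_single when_def split: if_splits)
    then show ?thesis using that(2) by (auto simp: lookup_single when_def)
  qed
qed

text \<open>Modulo \<open>esym1 UNIV\<close> the variable \<open>u\<close> equals minus the sum of
  the others. Monomials are treated by induction on their degree in \<open>u\<close>, and the
  quotients are then added up.\<close>

lemma eliminate_variable:
  fixes h :: "('v::finite, 'k::field) mpoly"
  shows "\<exists>w. h - esym1 UNIV * w \<in> monomial_ideal {n. lookup n u = 0}"
proof -
  let ?f = "esym1 UNIV :: ('v, 'k) mpoly" and ?s = "esym1 (- {u}) :: ('v, 'k) mpoly"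
  let ?F = "monomial_ideal {n. lookup n u = 0} :: ('v, 'k) mpoly set"
  have U: "UNIV = insert u (- {u})" by auto
  have f: "?f = Var u + ?s" unfolding U by (rule esym1_insert) auto
  have mult: "p * q \<in> ?F" if "p \<in> ?F" "q \<in> ?F" for p q
    by (rule monomial_ideal_mult_mono[OF that]) (auto simp: lookup_add)
  have ex: "\<exists>w. Poly_Mapping.single m c - ?f * w \<in> ?F" if "lookup m u = d" for d m c
    using that
  proof (induction d arbitrary: m)
    case 0
    then show ?case by (intro exI[of _ 0]) simp
  next
    case (Suc d)
    define m' where "m' = m - Poly_Mapping.single u 1"
    have m: "m = Poly_Mapping.single u 1 + m'"
      by (rule poly_mapping_eqI) (use Suc.prems in \<open>auto simp: m'_def lookup_add lookup_minus lookup_single when_def\<close>)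
    have ms: "Poly_Mapping.single m c = Var u * Poly_Mapping.single m' c"
      by (subst m) (simp add: Var_def mult_single)
    have "lookup m' u = d" using Suc.prems by (simp add: m'_def lookup_minus)
    then obtain w where w: "Poly_Mapping.single m' c - ?f * w \<in> ?F" using Suc.IH by blast
    have "Poly_Mapping.single m c - ?f * (Poly_Mapping.single m' c - ?s * w) =
        - ?s * (Poly_Mapping.single m' c - ?f * w)"
      unfolding ms f by (simp add: algebra_simps)
    moreover have "- ?s \<in> ?F" using monomial_ideal_diff[OF monomial_ideal_zero esym1_mem_degree[of u "- {u}"]] by simp
    ultimately have "Poly_Mapping.single m c - ?f * (Poly_Mapping.single m' c - ?s * w) \<in> ?F"
      using mult[OF _ w] by (simp only:)
    then show ?case by blast
  qed
  define W where "W m = (SOME w. Poly_Mapping.single m (lookup h m) - ?f * w \<in> ?F)" for m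
  have W: "Poly_Mapping.single m (lookup h m) - ?f * W m \<in> ?F" for m
    unfolding W_def by (rule someI_ex) (rule ex[OF refl])
  have "(\<Sum>m\<in>keys h. Poly_Mapping.single m (lookup h m) - ?f * W m) \<in> ?F"
    by (rule monomial_ideal_sum) (rule W)
  then have "h - ?f * (\<Sum>m\<in>keys h. W m) \<in> ?F"
    using poly_mapping_sum_single[of h] by (simp only: sum_subtractf sum_distrib_left)
  then show ?thesis by blast
qed

text \<open>Eliminating \<open>u\<close> turns \<open>esym2 UNIV\<close> into \<open>g'\<close>,
  which is free of \<open>u\<close> and equals minus the square of \<open>Var v\<close> plus terms
  of degree at most 1 in \<open>v\<close>. Up to sign it is monic in \<open>v\<close>, hence regular
  on the polynomials free of \<open>u\<close>.\<close>

lemma esym2_regular_mod_esym1: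
  fixes h :: "('v::finite, 'k::field) mpoly"
  assumes S: "upclosed S" and neq: "u \<noteq> v"
    and u: "\<And>m. m \<notin> S \<Longrightarrow> Poly_Mapping.single u 1 + m \<notin> S"
    and v: "\<And>m. m \<notin> S \<Longrightarrow> Poly_Mapping.single v 1 + m \<notin> S"
    and hw: "esym2 UNIV * h - esym1 UNIV * w \<in> monomial_ideal S"
  shows "\<exists>w'. h - esym1 UNIV * w' \<in> monomial_ideal S"
proof -
  let ?f = "esym1 UNIV :: ('v, 'k) mpoly" and ?g = "esym2 UNIV :: ('v, 'k) mpoly"
  let ?s = "esym1 (- {u}) :: ('v, 'k) mpoly"
  let ?F = "monomial_ideal {n. lookup n u = 0} :: ('v, 'k) mpoly set"
  define g' where "g' = esym2 (- {u}) - ?s * ?s"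
  have U: "UNIV = insert u (- {u})" by auto
  have f: "?f = Var u + ?s" unfolding U by (rule esym1_insert) auto
  have "?g = esym2 (- {u}) + Var u * ?s" unfolding U by (rule esym2_insert) auto
  then have g: "?g = ?f * ?s + g'" unfolding f g'_def by (simp add: algebra_simps)
  have mult: "p * q \<in> ?F" if "p \<in> ?F" "q \<in> ?F" for p q
    by (rule monomial_ideal_mult_mono[OF that]) (auto simp: lookup_add)
  obtain a where a: "h - ?f * a \<in> ?F" using eliminate_variable by blast
  define h0 where "h0 = h - ?f * a"
  have g'F: "g' \<in> ?F" unfolding g'_def
    using esym2_mem_degree[of "- {u}" u] esym1_mem_degree[of u "- {u}"] by (auto intro!: monomial_ideal_diff mult)
  then have F: "g' * h0 \<in> ?F" using a by (auto simp: h0_def intro: mult)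
  define w2 where "w2 = w - ?g * a - ?s * h0"
  have "?g * h - ?f * w = g' * h0 - ?f * w2"
    unfolding w2_def h0_def g by (simp add: algebra_simps)
  then have d: "g' * h0 - ?f * w2 \<in> monomial_ideal S" using hw by simp
  \<comment> \<open>Modulo \<open>S\<close> the product \<open>?f * w2\<close> agrees with
    \<open>g' * h0\<close>, which is free of \<open>u\<close>. Since \<open>?f\<close> is monic in
    \<open>u\<close>, no term of \<open>w2\<close> outside \<open>S\<close> can survive.\<close>
  have "w2 \<in> monomial_ideal S"
  proof (rule esym1_mult_mem_monomial_idealD[OF S u])
    fix m assume m: "m \<notin> S" "1 \<le> lookup m u"
    have "lookup (g' * h0) m = 0" using F m by (auto simp: monomial_ideal_iff)
    moreover have "lookup (g' * h0 - ?f * w2) m = 0" using d m by (auto simp: monomial_ideal_iff)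
    ultimately show "lookup (?f * w2) m = 0" by (simp add: lookup_minus)
  qed
  then have "?f * w2 \<in> monomial_ideal S" by (rule monomial_ideal_mult[OF S])
  then have g'h0: "g' * h0 \<in> monomial_ideal S" using monomial_ideal_add[OF d, of "?f * w2"] by simp
  let ?W = "- {u, v}"
  define p :: "('v, 'k) mpoly" where "p = esym2 ?W - Var v * esym1 ?W - esym1 ?W * esym1 ?W"
  have W: "- {u} = insert v ?W" using neq by auto
  have s: "?s = Var v + esym1 ?W" unfolding W by (rule esym1_insert) auto
  have "esym2 (- {u}) = esym2 ?W + Var v * (esym1 ?W :: ('v, 'k) mpoly)"
    unfolding W by (rule esym2_insert) auto
  then have "g' = p - Var v * Var v" unfolding g'_def p_def s by (simp add: algebra_simps)
  then have g'p: "g' = p - Poly_Mapping.single (Poly_Mapping.single v 2) 1"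
    by (simp add: Var_def mult_single numeral_2_eq_2 flip: single_add)
  have p1: "p \<in> monomial_ideal {n. lookup n v \<le> 1}"
  proof -
    have 0: "(esym2 ?W :: ('v, 'k) mpoly) \<in> monomial_ideal {n. lookup n v \<le> 0}" by (rule esym2_mem_degree) auto
    have 1: "(esym1 ?W :: ('v, 'k) mpoly) \<in> monomial_ideal {n. lookup n v \<le> 0}" using esym1_mem_degree[of v ?W] by simp
    have 2: "(Var v * esym1 ?W :: ('v, 'k) mpoly) \<in> monomial_ideal {n. lookup n v \<le> 1}"
      using mult_mem_degree[OF Var_mem_degree[of v v] 1] by simp
    have 3: "(esym1 ?W * esym1 ?W :: ('v, 'k) mpoly) \<in> monomial_ideal {n. lookup n v \<le> 0}" using mult_mem_degree[OF 1 1] by simp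
    have "monomial_ideal {n. lookup n v \<le> 0} \<subseteq> (monomial_ideal {n. lookup n v \<le> 1} :: ('v, 'k) mpoly set)"
      unfolding monomial_ideal_def by auto
    then show ?thesis unfolding p_def using 0 2 3 by (intro monomial_ideal_diff) auto
  qed
  have "h0 \<in> monomial_ideal S"
  proof (rule monic_mult_mem_monomial_idealD[OF S, where p = g' and u = v and d = 2])
    show "Poly_Mapping.single v 2 + m \<notin> S" if "m \<notin> S" for m
      using v[OF v[OF that]] by (simp add: numeral_2_eq_2 flip: add.assoc single_add)
    have "lookup p (Poly_Mapping.single v 2) = 0" using p1 by (auto simp: monomial_ideal_iff)
    then show "lookup g' (Poly_Mapping.single v 2) \<noteq> 0" by (simp add: g'p lookup_minus)
    show "lookup n v < 2" if "n \<in> keys g'" "n \<noteq> Poly_Mapping.single v 2" for n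
    proof -
      have "lookup p n \<noteq> 0" using that by (simp add: g'p in_keys_iff lookup_minus lookup_single when_def split: if_splits)
      then have "lookup n v \<le> 1" using p1 by (auto simp: monomial_ideal_iff)
      then show ?thesis by simp
    qed
    show "lookup (g' * h0) m = 0" if "m \<notin> S" for m
      using g'h0 that by (simp add: monomial_ideal_iff)
  qed
  then show ?thesis unfolding h0_def by blast
qed

section \<open>Depth and separating exponents\<close>

lemma lookup_single_mult:
  fixes h :: "('v, 'k::field) mpoly"
  shows "lookup (Poly_Mapping.single n 1 * h) (n + m) = lookup h m"
proof -
  define h' where "h' = h - Poly_Mapping.single m (lookup h m)"
  have "n + m \<notin> keys (Poly_Mapping.single n 1 * h')"
  proof
    assume "n + m \<in> keys (Poly_Mapping.single n 1 * h')"
    then have "m \<in> keys h'" using keys_mult[of "Poly_Mapping.single n 1" h'] by auto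
    then show False by (simp add: h'_def in_keys_iff lookup_minus)
  qed
  moreover have "Poly_Mapping.single n 1 * h =
      Poly_Mapping.single n 1 * h' + Poly_Mapping.single (n + m) (lookup h m)"
    by (simp add: h'_def algebra_simps mult_single)
  ultimately show ?thesis by (simp add: lookup_add in_keys_iff)
qed

lemma ideal_gen_monomial_ideal:
  "upclosed S \<Longrightarrow> ideal_gen (monomial_ideal S) = monomial_ideal S"
  using ideal_gen_subset_monomial_ideal[of S "monomial_ideal S"] by (auto intro: ideal_gen_base)

lemma depth_quot_ge:
  assumes "set fs \<subseteq> max_ideal" "regular_seq_quot J fs"
  shows "enat (length fs) \<le> depth_quot (J :: ('w, 'k::field) mpoly set)"
  unfolding depth_quot_def by (rule Sup_upper) (use assms in blast)

text \<open>Neighbours everywhere make \<open>A\<close> and \<open>B\<close> minimal covers; two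
  vertices on each side make every minimal cover miss two vertices, as needed for two regular
  elements.\<close>

locale thick_bigraph = bigraph A B E for A B :: "'v::finite set" and E +
  assumes ex_nbr: "\<exists>w. {v, w} \<in> E"
    and card_A: "2 \<le> card A" and card_B: "2 \<le> card B"
begin

lemma swap': "thick_bigraph B A E"
  by (intro thick_bigraph.intro swap thick_bigraph_axioms.intro ex_nbr card_A card_B)

section \<open>Minimal vertex covers and their primary components\<close>

definition min_vcover :: "'v set \<Rightarrow> bool" where
  "min_vcover C \<longleftrightarrow> vcover E C \<and> (\<forall>D. vcover E D \<longrightarrow> D \<subseteq> C \<longrightarrow> D = C)"

lemma vcover_contains_min:
  assumes "vcover E C"
  shows "\<exists>D\<subseteq>C. min_vcover D"
proof -
  obtain D where D: "vcover E D \<and> D \<subseteq> C"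
    and min: "\<And>D'. vcover E D' \<and> D' \<subseteq> C \<Longrightarrow> card D \<le> card D'"
    using ex_has_least_nat[of "\<lambda>D. vcover E D \<and> D \<subseteq> C" C card] assms by blast
  have "D' = D" if "vcover E D'" "D' \<subseteq> D" for D'
    using that D min[of D'] by (meson card_seteq finite order_trans)
  then show ?thesis using D unfolding min_vcover_def by blast
qed

lemma cover_exps_iff: "m \<in> cover_exps t \<longleftrightarrow> (\<forall>C. min_vcover C \<longrightarrow> t \<le> wt m C)"
proof
  assume H: "\<forall>C. min_vcover C \<longrightarrow> t \<le> wt m C"
  show "m \<in> cover_exps t"
    unfolding cover_exps_def mem_Collect_eq
  proof (intro allI impI)
    fix C assume "vcover E C"
    then obtain D where "D \<subseteq> C" "min_vcover D" using vcover_contains_min by blast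
    then show "t \<le> wt m C" using H wt_mono[of D C m] by force
  qed
qed (auto simp: cover_exps_def min_vcover_def)

lemma min_vcover_A: "min_vcover A"
  unfolding min_vcover_def
proof (intro conjI allI impI vcover_parts)
  fix D assume D: "vcover E D" "D \<subseteq> A"
  have "v \<in> D" if "v \<in> A" for v
  proof -
    obtain w where w: "{v, w} \<in> E" using ex_nbr by blast
    then have "w \<in> B" using edgeE[OF w] that parts_Int by (auto simp: doubleton_eq_iff)
    then have "w \<notin> D" using D parts_Int by auto
    moreover have "{v, w} \<inter> D \<noteq> {}" using D(1) w unfolding vcover_def by (rule bspec)
    ultimately show ?thesis by auto
  qed
  then show "D = A" using D by auto
qed

lemma min_vcover_B: "min_vcover B"
  by (rule thick_bigraph.min_vcover_A[OF swap'])

lemma min_vcover_eq: "min_vcover C \<Longrightarrow> vcover E D \<Longrightarrow> D \<subseteq> C \<Longrightarrow> C = D"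
  unfolding min_vcover_def by blast

lemma parts_nonempty: "A \<noteq> {}" "B \<noteq> {}"
  using card_A card_B by auto

text \<open>If \<open>C\<close> misses only \<open>u\<close>, removing any other \<open>v\<close>
  uncovers an edge, which can only be \<open>{u, v}\<close>. So \<open>u\<close> is adjacent to all
  other vertices and one side is contained in \<open>{u}\<close>.\<close>

lemma min_vcover_avoids_two:
  assumes C: "min_vcover C"
  shows "\<exists>u v. u \<noteq> v \<and> u \<notin> C \<and> v \<notin> C"
proof (rule ccontr)
  assume H: "\<not> ?thesis"
  have "\<exists>u. u \<notin> C"
  proof (rule ccontr)
    assume "\<not> ?thesis"
    then have "A \<subseteq> C" by auto
    then have "C = A" using min_vcover_eq[OF C] vcover_parts by auto
    then show False using parts_nonempty parts_Int \<open>\<not> (\<exists>u. u \<notin> C)\<close> by auto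
  qed
  then obtain u where u: "u \<notin> C" by blast
  have adj: "{u, v} \<in> E" if "v \<noteq> u" for v
  proof -
    have "v \<in> C" using H u that by blast
    then have "\<not> vcover E (C - {v})" using C unfolding min_vcover_def by blast
    then obtain e where e: "e \<in> E" "e \<inter> (C - {v}) = {}" unfolding vcover_def by blast
    then obtain a b where ab: "a \<in> A" "b \<in> B" "e = {a, b}" using edgeE by blast
    have "a \<in> {u, v}" "b \<in> {u, v}" using ab e H u by blast+
    moreover have "a \<noteq> b" using ab parts_Int by auto
    ultimately show ?thesis using ab e by (auto simp: insert_commute)
  qed
  have no: "\<not> 2 \<le> card X" if "X \<subseteq> {u}" for X :: "'v set"
    using card_mono[OF _ that] by simp
  have "u \<in> A \<longleftrightarrow> v \<notin> A" if "v \<noteq> u" for v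
    using edge_neq[OF adj[OF that]] .
  then have "A \<subseteq> {u} \<or> B \<subseteq> {u}" using in_B_iff by blast
  then show False using no card_A card_B by blast
qed

text \<open>The \<open>t\<close>-th power of the prime generated by the variables in
  \<open>C\<close>.\<close>

abbreviation local_ideal :: "nat \<Rightarrow> 'v set \<Rightarrow> ('v, 'k::field) mpoly set" where
  "local_ideal t C \<equiv> monomial_ideal {m. t \<le> wt m C}"

lemma mem_cover_ideal_iff:
  "p \<in> monomial_ideal (cover_exps t) \<longleftrightarrow> (\<forall>C. min_vcover C \<longrightarrow> p \<in> local_ideal t C)"
  unfolding monomial_ideal_def using cover_exps_iff by blast

lemma esym1_regular:
  fixes g :: "('v, 'k::field) mpoly"
  assumes "esym1 UNIV * g \<in> monomial_ideal (cover_exps t)"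
  shows "g \<in> monomial_ideal (cover_exps t)"
  unfolding mem_cover_ideal_iff
proof (intro allI impI)
  fix C assume C: "min_vcover C"
  obtain u where u: "u \<notin> C" using min_vcover_avoids_two[OF C] by blast
  have "esym1 UNIV * g \<in> local_ideal t C" using assms C mem_cover_ideal_iff by blast
  then show "g \<in> local_ideal t C"
    by (intro esym1_mult_mem_monomial_idealD[OF upclosed_wt wt_not_le_single[OF u]])
      (auto simp: monomial_ideal_iff)
qed

text \<open>In terms of degree complexes: the complex whose facets are the complements of the
  minimal covers of weight at most \<open>s\<close> consists of two disjoint simplices, on
  \<open>A\<close> and on \<open>B\<close>.\<close>

definition separating :: "('v \<Rightarrow> nat) \<Rightarrow> nat \<Rightarrow> bool" where
  "separating \<alpha> s \<longleftrightarrow> sum \<alpha> A = s \<and> sum \<alpha> B = s \<and>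
     (\<forall>C. vcover E C \<longrightarrow> sum \<alpha> C \<le> s \<longrightarrow> A \<subseteq> C \<or> B \<subseteq> C)"

text \<open>A light cover whose value differs from that at \<open>A\<close> must contain
  \<open>B\<close>, so it is \<open>B\<close>. A third light cover would miss a vertex together with
  \<open>A\<close> and another one together with \<open>B\<close>, and so equate their
  values.\<close>

lemma light_covers_are_parts:
  fixes c :: "'v set \<Rightarrow> 'c"
  assumes agree: "\<And>C D. min_vcover C \<Longrightarrow> min_vcover D \<Longrightarrow> L C \<Longrightarrow> L D \<Longrightarrow> C \<union> D \<noteq> UNIV \<Longrightarrow> c C = c D"
    and A: "L A" and C: "min_vcover C" "L C" and D: "min_vcover D" "L D" and neq: "c C \<noteq> c D"
  shows "L B \<and> (\<forall>F. min_vcover F \<longrightarrow> L F \<longrightarrow> F = A \<or> F = B)"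
proof -
  have is_B: "X = B" if "min_vcover X" "L X" "c X \<noteq> c A" for X
  proof -
    have "X \<union> A = UNIV" using agree[OF that(1) min_vcover_A that(2) A] that(3) by blast
    then have "B \<subseteq> X" using parts_Int by auto
    then show ?thesis using min_vcover_eq[OF that(1)] vcover_parts by blast
  qed
  have "C = B \<or> D = B" using is_B C D neq by metis
  then have B: "L B" "c B \<noteq> c A" using C D neq is_B by metis+
  have "F = A \<or> F = B" if F: "min_vcover F" "L F" for F
  proof (rule ccontr)
    assume "\<not> ?thesis"
    then have "\<not> A \<subseteq> F" "\<not> B \<subseteq> F" using min_vcover_eq[OF F(1)] vcover_parts by blast+
    then have "F \<union> A \<noteq> UNIV" "F \<union> B \<noteq> UNIV" using parts_Int by blast+
    then have "c F = c A" "c F = c B" using agree F A B min_vcover_A min_vcover_B by blast+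
    then show False using B by simp
  qed
  then show ?thesis using B by blast
qed

lemma separatingI:
  assumes t: "t \<ge> 1" and L: "wt m A < t" "wt m B < t"
    and light: "\<And>F. min_vcover F \<Longrightarrow> wt m F < t \<Longrightarrow> F = A \<or> F = B"
  shows "\<exists>\<alpha>. separating \<alpha> (t - 1)"
proof -
  obtain a b where ab: "a \<in> A" "b \<in> B" using parts_nonempty by auto
  \<comment> \<open>The weight missing from each part is put on a single vertex. This only makes
    covers heavier, so no new light cover arises.\<close>
  define \<alpha> where "\<alpha> v = lookup m v + ((if v = a then t - 1 - wt m A else 0) + (if v = b then t - 1 - wt m B else 0))" for v
  have sum\<alpha>: "sum \<alpha> C = wt m C + ((if a \<in> C then t - 1 - wt m A else 0) + (if b \<in> C then t - 1 - wt m B else 0))" for C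
    unfolding \<alpha>_def sum.distrib by (simp add: wt_def)
  have notin: "a \<notin> B" "b \<notin> A" using ab parts_Int by auto
  have "A \<subseteq> C \<or> B \<subseteq> C" if C: "vcover E C" "sum \<alpha> C \<le> t - 1" for C
  proof -
    obtain F where F: "F \<subseteq> C" "min_vcover F" using vcover_contains_min[OF C(1)] by blast
    have "wt m F \<le> wt m C" by (rule wt_mono[OF F(1)])
    then have "wt m F < t" using C(2) t unfolding sum\<alpha> by linarith
    then show ?thesis using light F by blast
  qed
  then have "separating \<alpha> (t - 1)"
    using L ab notin unfolding separating_def sum\<alpha> by auto
  then show ?thesis by blast
qed

text \<open>If \<open>c\<close> differs at two light covers \<open>C\<close> and \<open>D\<close>, then \<open>C \<union> D\<close> is everything, so \<open>A\<close> and \<open>B\<close> together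
  weigh at most as much as \<open>C\<close> and \<open>D\<close>, and one of the parts is light as well.\<close>

lemma separating_or_constant:
  fixes c :: "'v set \<Rightarrow> 'c"
  assumes agree: "\<And>C D. min_vcover C \<Longrightarrow> min_vcover D \<Longrightarrow> wt m C < t \<Longrightarrow> wt m D < t \<Longrightarrow>
      C \<union> D \<noteq> UNIV \<Longrightarrow> c C = c D"
    and C: "min_vcover C" "wt m C < t" and D: "min_vcover D" "wt m D < t" and neq: "c C \<noteq> c D"
  shows "\<exists>\<alpha>. separating \<alpha> (t - 1)"
proof -
  have t: "t \<ge> 1" using C by simp
  have "C \<union> D = UNIV" using agree C D neq by blast
  then have "wt m UNIV + wt m (C \<inter> D) = wt m C + wt m D"
    using sum.union_inter[of C D "lookup m"] by (simp add: wt_def)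
  moreover have "wt m A + wt m B = wt m UNIV"
    using sum.union_disjoint[of A B "lookup m"] parts_Un parts_Int by (simp add: wt_def)
  ultimately have "wt m A < t \<or> wt m B < t" using C D by linarith
  then show ?thesis
  proof
    assume A: "wt m A < t"
    have "wt m B < t \<and> (\<forall>F. min_vcover F \<longrightarrow> wt m F < t \<longrightarrow> F = A \<or> F = B)"
      by (rule light_covers_are_parts[where L = "\<lambda>C. wt m C < t" and c = c, OF agree A C D neq])
    then show ?thesis using separatingI[OF t A] by blast
  next
    assume B: "wt m B < t"
    have "wt m A < t \<and> (\<forall>F. min_vcover F \<longrightarrow> wt m F < t \<longrightarrow> F = B \<or> F = A)"
      by (rule thick_bigraph.light_covers_are_parts[OF swap', where L = "\<lambda>C. wt m C < t" and c = c,
            OF agree B C D neq])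
    then show ?thesis using separatingI[OF t _ B] by blast
  qed
qed

section \<open>Regularity of \<open>esym1\<close> and \<open>esym2\<close> on the quotient\<close>

lemma ideal_gen_cover_ideal:
  "ideal_gen (monomial_ideal (cover_exps t)) = (monomial_ideal (cover_exps t) :: ('v, 'k::field) mpoly set)"
  by (rule ideal_gen_monomial_ideal[OF upclosed_cover_exps])

lemma proper_ideal_gen:
  fixes F :: "('v, 'k::field) mpoly set"
  assumes t: "t \<ge> 1" and F: "F \<subseteq> monomial_ideal (- {0})"
  shows "ideal_gen (monomial_ideal (cover_exps t) \<union> F) \<noteq> UNIV"
proof -
  have "upclosed (- {0 :: 'v \<Rightarrow>\<^sub>0 nat})"
    by (auto simp: upclosed_def poly_mapping_eq_iff lookup_add fun_eq_iff)
  moreover have "0 \<notin> cover_exps t"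
    using t vcover_parts by (auto simp: cover_exps_def)
  then have "monomial_ideal (cover_exps t) \<subseteq> (monomial_ideal (- {0}) :: ('v, 'k) mpoly set)"
    unfolding monomial_ideal_def by auto
  ultimately have "ideal_gen (monomial_ideal (cover_exps t) \<union> F) \<subseteq> monomial_ideal (- {0})"
    using F by (intro ideal_gen_subset_monomial_ideal) auto
  moreover have "1 \<notin> (monomial_ideal (- {0}) :: ('v, 'k) mpoly set)"
    by (auto simp: monomial_ideal_def)
  ultimately show ?thesis by blast
qed

lemma regular_seq_esym1:
  assumes "t \<ge> 1"
  shows "regular_seq_quot (monomial_ideal (cover_exps t) :: ('v, 'k::field) mpoly set) [esym1 UNIV]"
  unfolding regular_seq_quot_def
  using esym1_regular proper_ideal_gen[OF assms, of "{esym1 UNIV}"] max_ideal_subset esym1_mem_max_ideal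
  by (fastforce simp: ideal_gen_cover_ideal)

lemma esym2_regular:
  fixes g :: "('v, 'k::field) mpoly"
  assumes nosep: "\<not> (\<exists>\<alpha>. separating \<alpha> (t - 1))"
    and g: "esym2 UNIV * g \<in> ideal_gen (monomial_ideal (cover_exps t) \<union> {esym1 UNIV})"
  shows "g \<in> ideal_gen (monomial_ideal (cover_exps t) \<union> {esym1 UNIV})"
proof -
  let ?f = "esym1 UNIV :: ('v, 'k) mpoly"
  obtain w0 where w0: "esym2 UNIV * g - ?f * w0 \<in> monomial_ideal (cover_exps t)"
    using g ideal_gen_Un_insert[OF ideal_gen_cover_ideal] by blast
  have ex: "\<exists>w. g - ?f * w \<in> local_ideal t C" if C: "min_vcover C" for C
  proof -
    obtain u v where uv: "u \<noteq> v" "u \<notin> C" "v \<notin> C" using min_vcover_avoids_two[OF C] by blast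
    show ?thesis
    proof (rule esym2_regular_mod_esym1[OF upclosed_wt uv(1)])
      show "esym2 UNIV * g - ?f * w0 \<in> local_ideal t C" using w0 C mem_cover_ideal_iff by blast
    qed (fact wt_not_le_single[OF uv(2)] wt_not_le_single[OF uv(3)])+
  qed
  define W where "W C = (SOME w. g - ?f * w \<in> local_ideal t C)" for C
  have W: "g - ?f * W C \<in> local_ideal t C" if "min_vcover C" for C
    unfolding W_def by (rule someI_ex[OF ex[OF that]])
  have agree: "lookup (W C) m = lookup (W D) m"
    if C: "min_vcover C" and D: "min_vcover D" and CD: "C \<union> D \<noteq> UNIV"
      and m: "wt m C < t" "wt m D < t" for C D m
  proof -
    obtain u where u: "u \<notin> C" "u \<notin> D" using CD by auto
    \<comment> \<open>Modulo the sum of the two local ideals both quotients solve the same equation,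
      and \<open>?f\<close> is regular there because \<open>u\<close> is missed by both
      covers.\<close>
    let ?S = "{m. t \<le> wt m C} \<union> {m. t \<le> wt m D}"
    have 1: "g - ?f * W C \<in> monomial_ideal ?S" "g - ?f * W D \<in> monomial_ideal ?S"
      using W[OF C] W[OF D] unfolding monomial_ideal_def by auto
    have "?f * (W D - W C) = (g - ?f * W C) - (g - ?f * W D)" by (simp add: algebra_simps)
    then have 2: "?f * (W D - W C) \<in> monomial_ideal ?S" using monomial_ideal_diff[OF 1] by simp
    have "W D - W C \<in> monomial_ideal ?S"
    proof (rule esym1_mult_mem_monomial_idealD)
      show "upclosed ?S" by (intro upclosed_Un upclosed_wt)
      show "Poly_Mapping.single u 1 + m \<notin> ?S" if "m \<notin> ?S" for m
        using that wt_not_le_single[OF u(1), of m t] wt_not_le_single[OF u(2), of m t] by simp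
      show "lookup (?f * (W D - W C)) m = 0" if "m \<notin> ?S" for m
        using 2 that by (simp add: monomial_ideal_iff)
    qed
    then have "lookup (W D - W C) m = 0" using m by (auto simp: monomial_ideal_iff)
    then show ?thesis by (simp add: lookup_minus)
  qed
  have agree': "lookup (W C) m = lookup (W D) m"
    if "min_vcover C" "min_vcover D" "wt m C < t" "wt m D < t" for C D m
  proof (rule ccontr)
    assume "lookup (W C) m \<noteq> lookup (W D) m"
    then have "\<exists>\<alpha>. separating \<alpha> (t - 1)"
      by (intro separating_or_constant[where c = "\<lambda>C. lookup (W C) m", OF agree that(1,3) that(2,4)])
    then show False using nosep by blast
  qed
  define P where "P m C \<longleftrightarrow> min_vcover C \<and> wt m C < t" for m C
  \<comment> \<open>The glued coefficient is read off at any cover light for \<open>m\<close>;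
    exponents heavy for all covers are irrelevant and get 0. Finitely many covers keep the support
    finite.\<close>
  define wf where "wf m = (if \<exists>C. P m C then lookup (W (SOME C. P m C)) m else 0)" for m
  define w where "w = Abs_poly_mapping wf"
  have "{m. wf m \<noteq> 0} \<subseteq> (\<Union>C\<in>UNIV. keys (W C))"
    by (auto simp: wf_def in_keys_iff split: if_splits)
  then have fin: "finite {m. wf m \<noteq> 0}" by (rule finite_subset) simp
  have w: "lookup w m = lookup (W C) m" if "min_vcover C" "wt m C < t" for m C
  proof -
    have "P m C" using that by (simp add: P_def)
    then have "P m (SOME C. P m C)" by (rule someI)
    then have "lookup (W (SOME C. P m C)) m = lookup (W C) m"
      using that by (intro agree') (auto simp: P_def)
    then show ?thesis using \<open>P m C\<close> fin by (auto simp: w_def wf_def)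
  qed
  have "g - ?f * w \<in> local_ideal t C" if C: "min_vcover C" for C
  proof -
    \<comment> \<open>\<open>w\<close> and \<open>W C\<close> can differ only at exponents that are
      heavy for \<open>C\<close>.\<close>
    have "w - W C \<in> local_ideal t C"
      using w[OF C] by (auto simp: monomial_ideal_iff lookup_minus)
    then have "?f * (w - W C) \<in> local_ideal t C" by (rule monomial_ideal_mult[OF upclosed_wt])
    then have "(g - ?f * W C) - ?f * (w - W C) \<in> local_ideal t C"
      by (rule monomial_ideal_diff[OF W[OF C]])
    then show ?thesis by (simp add: algebra_simps)
  qed
  then have "g - ?f * w \<in> monomial_ideal (cover_exps t)" using mem_cover_ideal_iff by blast
  then show ?thesis using ideal_gen_Un_insert[OF ideal_gen_cover_ideal] by blast
qed

lemma regular_seq_esym2: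
  assumes "t \<ge> 1" and "\<not> (\<exists>\<alpha>. separating \<alpha> (t - 1))"
  shows "regular_seq_quot (monomial_ideal (cover_exps t) :: ('v, 'k::field) mpoly set) [esym1 UNIV, esym2 UNIV]"
  unfolding regular_seq_quot_def
proof (intro conjI allI impI)
  let ?J = "monomial_ideal (cover_exps t) :: ('v, 'k) mpoly set"
  let ?fs = "[esym1 UNIV, esym2 UNIV :: ('v, 'k) mpoly]"
  show "ideal_gen (?J \<union> set ?fs) \<noteq> UNIV"
    by (rule proper_ideal_gen[OF assms(1)]) (use max_ideal_subset esym1_mem_max_ideal esym2_mem_max_ideal in auto)
  fix i g assume i: "i < length ?fs" and g: "?fs ! i * g \<in> ideal_gen (?J \<union> set (take i ?fs))"
  consider "i = 0" | "i = 1" using i by fastforce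
  then show "g \<in> ideal_gen (?J \<union> set (take i ?fs))"
  proof cases
    case 1
    then show ?thesis using g esym1_regular by (simp add: ideal_gen_cover_ideal)
  next
    case 2
    have "g \<in> ideal_gen (?J \<union> {esym1 UNIV})"
      by (rule esym2_regular[OF assms(2)]) (use 2 g in simp)
    then show ?thesis using 2 by simp
  qed
qed

section \<open>Depth at most 1 at a separating exponent\<close>

lemma max_ideal_split:
  assumes "p \<in> (max_ideal :: ('v, 'k::field) mpoly set)"
  shows "\<exists>q r. p = q + r \<and> q \<in> local_ideal 1 A \<and> r \<in> local_ideal 1 B"
proof -
  have "range Var \<subseteq> {p :: ('v, 'k) mpoly. \<exists>q r. p = q + r \<and> q \<in> local_ideal 1 A \<and> r \<in> local_ideal 1 B}" (is "_ \<subseteq> ?X")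
  proof
    fix p :: "('v, 'k) mpoly" assume "p \<in> range Var"
    then obtain v where v: "p = Var v" by auto
    show "p \<in> ?X"
    proof (cases "v \<in> A")
      case True
      then have "p = p + 0 \<and> p \<in> local_ideal 1 A \<and> 0 \<in> (local_ideal 1 B :: ('v, 'k) mpoly set)"
        unfolding v Var_mem_monomial_ideal by (simp add: wt_single)
      then show ?thesis by blast
    next
      case False
      then have "p = 0 + p \<and> 0 \<in> (local_ideal 1 A :: ('v, 'k) mpoly set) \<and> p \<in> local_ideal 1 B"
        unfolding v Var_mem_monomial_ideal using in_B_iff by (simp add: wt_single)
      then show ?thesis by blast
    qed
  qed
  moreover have "module.subspace (*) ?X"
    unfolding module.subspace_def[OF module_times]
  proof (intro conjI ballI allI)
    show "0 \<in> ?X" by (intro CollectI exI[of _ 0]) simp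
    fix x y c assume "x \<in> ?X"
    then obtain q r where x: "x = q + r" "q \<in> local_ideal 1 A" "r \<in> local_ideal 1 B" by blast
    have "c * x = c * q + c * r" by (simp add: x distrib_left)
    moreover have "c * q \<in> local_ideal 1 A" "c * r \<in> local_ideal 1 B"
      using x by (auto intro: monomial_ideal_mult upclosed_wt)
    ultimately show "c * x \<in> ?X" by blast
    assume "y \<in> ?X"
    then obtain q' r' where y: "y = q' + r'" "q' \<in> local_ideal 1 A" "r' \<in> local_ideal 1 B" by blast
    have "x + y = (q + q') + (r + r')" by (simp add: x y)
    moreover have "q + q' \<in> local_ideal 1 A" "r + r' \<in> local_ideal 1 B"
      using x y by (auto intro: monomial_ideal_add)
    ultimately show "x + y \<in> ?X" by blast
  qed
  ultimately show ?thesis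
    using assms module.span_minimal[OF module_times, of "range Var" ?X]
    unfolding max_ideal_def ideal_gen_def by blast
qed

lemma min_vcover_meets_B: "min_vcover C \<Longrightarrow> C \<noteq> A \<Longrightarrow> \<exists>b\<in>B. b \<in> C"
proof (rule ccontr)
  assume C: "min_vcover C" "C \<noteq> A" "\<not> (\<exists>b\<in>B. b \<in> C)"
  then have "C \<subseteq> A" using parts_Un by auto
  then have "A = C" using min_vcover_eq[OF min_vcover_A] C(1) unfolding min_vcover_def by blast
  then show False using C(2) by simp
qed

text \<open>The monomial \<open>\<Prod>\<^sub>b x\<^sub>b\<^sup>t\<close> over \<open>B\<close> lies in every local ideal except the one at \<open>A\<close>, where it
  is a nonzerodivisor; so it localizes regularity from the power of the edge ideal to \<open>A\<close>.\<close>

lemma regular_local_ideal_A: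
  fixes f h :: "('v, 'k::field) mpoly"
  assumes reg: "\<And>h. f * h \<in> monomial_ideal (cover_exps t) \<Longrightarrow> h \<in> monomial_ideal (cover_exps t)"
    and fh: "f * h \<in> local_ideal t A"
  shows "h \<in> local_ideal t A"
proof -
  define n where "n = Abs_poly_mapping (\<lambda>v. if v \<in> B then t else 0)"
  have lk: "lookup n v = (if v \<in> B then t else 0)" for v
    by (simp add: n_def)
  define x where "x = (Poly_Mapping.single n 1 :: ('v, 'k) mpoly)"
  have "f * (x * h) \<in> local_ideal t C" if C: "min_vcover C" for C
  proof (cases "C = A")
    case True
    then show ?thesis using monomial_ideal_mult[OF upclosed_wt fh, of x] by (simp add: mult.left_commute)
  next
    case False
    then obtain b where b: "b \<in> B" "b \<in> C" using min_vcover_meets_B C by blast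
    have "lookup n b \<le> wt n C" unfolding wt_def by (rule member_le_sum) (use b in auto)
    then have "x \<in> local_ideal t C" using b by (simp add: x_def lk)
    then have "(f * h) * x \<in> local_ideal t C" by (rule monomial_ideal_mult[OF upclosed_wt])
    then show ?thesis by (simp add: mult_ac)
  qed
  then have "x * h \<in> monomial_ideal (cover_exps t)" using reg mem_cover_ideal_iff by blast
  then have xh: "x * h \<in> local_ideal t A" using mem_cover_ideal_iff min_vcover_A by blast
  have "wt n A = 0" unfolding wt_def lk using parts_Int by (intro sum.neutral) auto
  show ?thesis
    unfolding monomial_ideal_iff
  proof (intro allI impI)
    fix m assume "m \<notin> {m. t \<le> wt m A}"
    then have "n + m \<notin> {m. t \<le> wt m A}" using \<open>wt n A = 0\<close> by (simp add: wt_add)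
    then have "lookup (x * h) (n + m) = 0" using xh by (simp add: monomial_ideal_iff)
    then show "lookup h m = 0" by (simp add: x_def lookup_single_mult)
  qed
qed

text \<open>Multiplying by an element \<open>f = f\<^sub>A + f\<^sub>B\<close> of the maximal ideal turns the function that is
  the monomial of exponent \<open>\<alpha>\<close> at the minimal cover \<open>A\<close> and zero at \<open>B\<close> into the global element
  \<open>f\<^sub>B x\<^sup>\<alpha>\<close>. Two such elements, for \<open>f\<close> and for \<open>g\<close>, contradict the regularity of \<open>f, g\<close>.\<close>

lemma no_regular_pair:
  fixes f g :: "('v, 'k::field) mpoly" and t :: nat
  defines "J \<equiv> monomial_ideal (cover_exps t) :: ('v, 'k) mpoly set"
  assumes t: "t \<ge> 1" and sep: "separating \<alpha> (t - 1)"
    and f: "f \<in> max_ideal" and g: "g \<in> max_ideal"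
    and reg1: "\<And>h. f * h \<in> J \<Longrightarrow> h \<in> J"
    and reg2: "\<And>h. g * h \<in> ideal_gen (J \<union> {f}) \<Longrightarrow> h \<in> ideal_gen (J \<union> {f})"
  shows False
proof -
  define m where "m = Abs_poly_mapping \<alpha>"
  have lk: "lookup m = \<alpha>" by (simp add: m_def)
  define x where "x = (Poly_Mapping.single m 1 :: ('v, 'k) mpoly)"
  have wtm: "wt m A = t - 1" "wt m B = t - 1"
    using sep by (simp_all add: separating_def wt_def lk)
  have heavy: "t \<le> wt m C" if "min_vcover C" "C \<noteq> A" "C \<noteq> B" for C
  proof (rule ccontr)
    assume "\<not> t \<le> wt m C"
    then have "sum \<alpha> C \<le> t - 1" by (simp add: wt_def lk)
    then have "A \<subseteq> C \<or> B \<subseteq> C" using sep that(1) unfolding separating_def min_vcover_def by blast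
    then show False using min_vcover_eq[OF that(1)] vcover_parts that by blast
  qed
  have x_heavy: "p * x \<in> local_ideal t C" if "min_vcover C" "C \<noteq> A" "C \<noteq> B" for p C
    using heavy[OF that] by (intro monomial_ideal_mult upclosed_wt) (simp add: x_def)
  \<comment> \<open>On both parts \<open>x\<close> has weight \<open>t - 1\<close>, so one more
    degree suffices.\<close>
  have x_part: "p * x \<in> local_ideal t C" if p: "p \<in> local_ideal 1 C" and "C = A \<or> C = B" for p C
  proof (rule monomial_ideal_mult_mono[OF p])
    show "x \<in> monomial_ideal {m}" by (simp add: x_def)
    show "n + m' \<in> {m. t \<le> wt m C}" if "n \<in> {m. 1 \<le> wt m C}" "m' \<in> {m}" for n m'
      using that \<open>C = A \<or> C = B\<close> wtm by (auto simp: wt_add)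
  qed
  obtain fA fB where fAB: "f = fA + fB" "fA \<in> local_ideal 1 A" "fB \<in> local_ideal 1 B"
    using max_ideal_split[OF f] by blast
  obtain gA gB where gAB: "g = gA + gB" "gA \<in> local_ideal 1 A" "gB \<in> local_ideal 1 B"
    using max_ideal_split[OF g] by blast
  have AB: "p * q * x \<in> J" if p: "p \<in> local_ideal 1 A" and q: "q \<in> local_ideal 1 B" for p q
    unfolding J_def mem_cover_ideal_iff
  proof (intro allI impI)
    fix C assume C: "min_vcover C"
    consider "C = A" | "C = B" | "C \<noteq> A" "C \<noteq> B" by blast
    then show "p * q * x \<in> local_ideal t C"
    proof cases
      case 1
      then have "q * (p * x) \<in> local_ideal t C"
        using p by (intro monomial_ideal_mult[OF upclosed_wt] x_part) auto
      then show ?thesis by (simp add: mult_ac)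
    next
      case 2
      then have "p * (q * x) \<in> local_ideal t C"
        using q by (intro monomial_ideal_mult[OF upclosed_wt] x_part) auto
      then show ?thesis by (simp add: mult_ac)
    next
      case 3
      then show ?thesis using x_heavy C by blast
    qed
  qed
  have J: "ideal_gen J = J" unfolding J_def by (rule ideal_gen_cover_ideal)
  \<comment> \<open>The terms with \<open>fB * gB\<close> cancel; each remaining one has a factor
    from both parts.\<close>
  have "g * (fB * x) - f * (gB * x) = gA * fB * x - fA * gB * x"
    unfolding fAB(1) gAB(1) by (simp add: algebra_simps)
  also have "\<dots> \<in> J"
    using AB[OF gAB(2) fAB(3)] AB[OF fAB(2) gAB(3)] unfolding J_def by (rule monomial_ideal_diff)
  finally have "fB * x \<in> ideal_gen (J \<union> {f})"
    using reg2 ideal_gen_Un_insert[OF J] by blast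
  then obtain w where w: "fB * x - f * w \<in> J" using ideal_gen_Un_insert[OF J] by blast
  have JA: "J \<subseteq> local_ideal t A" and JB: "J \<subseteq> local_ideal t B"
    unfolding J_def using mem_cover_ideal_iff min_vcover_A min_vcover_B by blast+
  \<comment> \<open>At \<open>A\<close> the quotient \<open>w\<close> must agree with
    \<open>x\<close>, at \<open>B\<close> it must vanish. Both conditions fix its coefficient at
    \<open>m\<close>, which is light for both parts: 1 against 0.\<close>
  have "f * (x - w) = fA * x + (fB * x - f * w)" unfolding fAB(1) by (simp add: algebra_simps)
  also have "\<dots> \<in> local_ideal t A"
    using w JA x_part[OF fAB(2)] by (intro monomial_ideal_add) auto
  finally have "x - w \<in> local_ideal t A"
    using regular_local_ideal_A reg1 unfolding J_def by blast
  then have "lookup (x - w) m = 0" using wtm t by (simp add: monomial_ideal_iff)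
  then have w1: "lookup w m = 1" by (simp add: x_def lookup_minus)
  have "f * w = fB * x - (fB * x - f * w)" by simp
  also have "\<dots> \<in> local_ideal t B"
    by (rule monomial_ideal_diff[OF x_part[OF fAB(3)] subsetD[OF JB w]]) simp
  finally have "f * w \<in> local_ideal t B" .
  then have "w \<in> local_ideal t B"
    using thick_bigraph.regular_local_ideal_A[OF swap', of f t w] reg1 unfolding J_def by blast
  then have "lookup w m = 0" using wtm t by (simp add: monomial_ideal_iff)
  then show False using w1 by simp
qed

lemma depth_quot_le_1:
  assumes t: "t \<ge> 1" and sep: "separating \<alpha> (t - 1)"
  shows "depth_quot (monomial_ideal (cover_exps t) :: ('v, 'k::field) mpoly set) \<le> 1"
  unfolding depth_quot_def
proof (rule Sup_least, safe)
  let ?J = "monomial_ideal (cover_exps t) :: ('v, 'k) mpoly set"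
  fix fs :: "('v, 'k) mpoly list"
  assume fs: "set fs \<subseteq> max_ideal" and reg: "regular_seq_quot ?J fs"
  have "\<not> 2 \<le> length fs"
  proof
    assume len: "2 \<le> length fs"
    then obtain f g gs where fg: "fs = f # g # gs"
      by (metis Suc_1 Suc_le_length_iff One_nat_def)
    have r: "fs ! i * h \<in> ideal_gen (?J \<union> set (take i fs)) \<Longrightarrow> h \<in> ideal_gen (?J \<union> set (take i fs))"
      if "i < length fs" for i h
      using reg that unfolding regular_seq_quot_def by blast
    have reg1: "h \<in> ?J" if "f * h \<in> ?J" for h
      using r[of 0 h] that fg by (simp add: ideal_gen_cover_ideal)
    have reg2: "h \<in> ideal_gen (?J \<union> {f})" if "g * h \<in> ideal_gen (?J \<union> {f})" for h
      using r[of 1 h] that fg by simp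
    show False
      by (rule no_regular_pair[OF t sep _ _ reg1 reg2]) (use fs fg in auto)
  qed
  then show "enat (length fs) \<le> 1" by (simp add: one_enat_def)
qed

theorem depth_quot_eq_1:
  assumes t: "t \<ge> 1" and sep: "separating \<alpha> (t - 1)"
  shows "depth_quot (monomial_ideal (cover_exps t) :: ('v, 'k::field) mpoly set) = 1"
proof (rule antisym[OF depth_quot_le_1[OF assms]])
  show "1 \<le> depth_quot (monomial_ideal (cover_exps t) :: ('v, 'k) mpoly set)"
    using depth_quot_ge[OF _ regular_seq_esym1[OF t], where 'k = 'k]
    by (simp add: one_enat_def esym1_mem_max_ideal)
qed

theorem depth_quot_ge_2:
  assumes t: "t \<ge> 1" and "\<not> (\<exists>\<alpha>. separating \<alpha> (t - 1))"
  shows "2 \<le> depth_quot (monomial_ideal (cover_exps t) :: ('v, 'k::field) mpoly set)"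
proof -
  have "set [esym1 UNIV, esym2 UNIV] \<subseteq> (max_ideal :: ('v, 'k) mpoly set)"
    by (simp add: esym1_mem_max_ideal esym2_mem_max_ideal)
  from depth_quot_ge[OF this regular_seq_esym2[OF assms]]
  show ?thesis by (simp add: numeral_eq_enat numeral_2_eq_2)
qed

end

section \<open>Cycles\<close>

definition is_cycle :: "'v set set \<Rightarrow> 'v list \<Rightarrow> bool" where
  "is_cycle E ws \<longleftrightarrow> length ws \<ge> 3 \<and> distinct ws \<and>
     (\<forall>j<length ws. {ws ! j, ws ! (Suc j mod length ws)} \<in> E)"

definition cycle_edge :: "'v list \<Rightarrow> nat \<Rightarrow> 'v set" where
  "cycle_edge ws j = {ws ! j, ws ! (Suc j mod length ws)}"

definition cycle_edges :: "'v list \<Rightarrow> 'v set set" where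
  "cycle_edges ws = cycle_edge ws ` {..<length ws}"

lemma Suc_mod_eq: "j < L \<Longrightarrow> Suc j mod L = (if Suc j = L then 0 else Suc j)"
  by auto

lemma cycle_edge_mem: "is_cycle E ws \<Longrightarrow> j < length ws \<Longrightarrow> cycle_edge ws j \<in> E"
  by (simp add: is_cycle_def cycle_edge_def)

lemma cycle_edges_subset: "is_cycle E ws \<Longrightarrow> cycle_edges ws \<subseteq> E"
  by (auto simp: cycle_edges_def cycle_edge_mem)

lemma Suc_mod_less: "j < L \<Longrightarrow> Suc j mod L < (L :: nat)"
  by simp

lemma cycle_edge_subset_set: "j < length ws \<Longrightarrow> cycle_edge ws j \<subseteq> set ws"
  using Suc_mod_less[of j "length ws"] by (auto simp: cycle_edge_def intro: nth_mem)

text \<open>Equality with the ends exchanged would make two steps along the cycle return to the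
  start, impossible for length at least 3.\<close>

lemma cycle_edge_inj:
  assumes ws: "is_cycle E ws" and j: "j < length ws" "k < length ws"
    and eq: "cycle_edge ws j = cycle_edge ws k"
  shows "j = k"
proof -
  let ?L = "length ws"
  have d: "distinct ws" and L: "3 \<le> ?L" using ws by (auto simp: is_cycle_def)
  have lt: "Suc j mod ?L < ?L" "Suc k mod ?L < ?L" by (rule Suc_mod_less[OF j(1)], rule Suc_mod_less[OF j(2)])
  have "ws ! j = ws ! k \<or> (ws ! j = ws ! (Suc k mod ?L) \<and> ws ! (Suc j mod ?L) = ws ! k)"
    using eq by (auto simp: cycle_edge_def doubleton_eq_iff)
  then have "j = k \<or> (j = Suc k mod ?L \<and> Suc j mod ?L = k)"
    using d j lt by (simp add: nth_eq_iff_index_eq)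
  then show ?thesis
    using j L by (auto simp: Suc_mod_eq split: if_splits)
qed

lemma cycle_two_neighbours:
  assumes ws: "is_cycle E ws" and v: "v \<in> set ws"
  shows "\<exists>x y. x \<noteq> y \<and> {v, x} \<in> E \<and> {v, y} \<in> E"
proof -
  let ?L = "length ws"
  have d: "distinct ws" and L: "3 \<le> ?L" using ws by (auto simp: is_cycle_def)
  obtain j where j: "j < ?L" "v = ws ! j" using v by (auto simp: in_set_conv_nth)
  define i where "i = (if j = 0 then ?L - 1 else j - 1)"
  have i: "i < ?L" "Suc i mod ?L = j" using j(1) L by (cases j; simp add: i_def)+
  have "i \<noteq> Suc j mod ?L" unfolding Suc_mod_eq[OF j(1)] using j(1) L by (cases j; simp add: i_def)
  then have "ws ! i \<noteq> ws ! (Suc j mod ?L)"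
    using d i(1) Suc_mod_less[OF j(1)] by (simp add: nth_eq_iff_index_eq)
  moreover have "{v, ws ! (Suc j mod ?L)} \<in> E" using cycle_edge_mem[OF ws j(1)] by (simp add: cycle_edge_def j)
  moreover have "{v, ws ! i} \<in> E" using cycle_edge_mem[OF ws i(1)] i(2) by (simp add: cycle_edge_def j insert_commute)
  ultimately show ?thesis by blast
qed

lemma sum_cyclic_shift:
  fixes f :: "nat \<Rightarrow> nat"
  shows "(\<Sum>j<L. f (Suc j mod L)) = (\<Sum>j<L. f j)"
proof (cases L)
  case (Suc k)
  have "(\<Sum>j<k. f (Suc j mod Suc k)) = (\<Sum>j<k. f (Suc j))"
    by (rule sum.cong) simp_all
  moreover have "(\<Sum>j<Suc k. f (Suc j mod Suc k)) = (\<Sum>j<k. f (Suc j mod Suc k)) + f 0"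
    unfolding sum.lessThan_Suc mod_self ..
  moreover have "(\<Sum>j<Suc k. f j) = f 0 + (\<Sum>j<k. f (Suc j))"
    by (rule sum.lessThan_Suc_shift)
  ultimately show ?thesis unfolding Suc by linarith
qed simp

text \<open>Each vertex of the cycle is counted from its two cycle edges.\<close>

lemma card_Int_cycle:
  assumes ws: "is_cycle E ws"
  shows "2 * card (C \<inter> set ws) = (\<Sum>j<length ws. of_bool (ws ! j \<in> C) + of_bool (ws ! (Suc j mod length ws) \<in> C))"
proof -
  have d: "distinct ws" using ws by (simp add: is_cycle_def)
  have "card (C \<inter> set ws) = (\<Sum>x\<in>set ws. of_bool (x \<in> C))" by (simp add: Int_commute)
  also have "\<dots> = (\<Sum>j<length ws. of_bool (ws ! j \<in> C))"
    by (rule sum.reindex_bij_betw[OF bij_betw_nth[OF d refl refl], symmetric])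
  finally show ?thesis
    using sum_cyclic_shift[of "\<lambda>j. of_bool (ws ! j \<in> C)" "length ws"] by (simp add: sum.distrib)
qed

lemma vcover_cycle_card:
  assumes ws: "is_cycle E ws" and C: "vcover E C"
  shows "length ws \<le> 2 * card (C \<inter> set ws)"
proof -
  have "(\<Sum>j<length ws. 1) \<le> (\<Sum>j<length ws. of_bool (ws ! j \<in> C) + of_bool (ws ! (Suc j mod length ws) \<in> C) :: nat)"
  proof (rule sum_mono)
    fix j assume "j \<in> {..<length ws}"
    then have "cycle_edge ws j \<inter> C \<noteq> {}" using C cycle_edge_mem[OF ws] unfolding vcover_def by blast
    then show "1 \<le> of_bool (ws ! j \<in> C) + (of_bool (ws ! (Suc j mod length ws) \<in> C) :: nat)"
      by (auto simp: cycle_edge_def)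
  qed
  then show ?thesis using card_Int_cycle[OF ws, of C] by simp
qed

text \<open>Equality in the sum over the cycle edges forces exactly one end of each edge into
  \<open>C\<close>.\<close>

lemma tight_vcover_cycle:
  assumes ws: "is_cycle E ws" and C: "vcover E C" and eq: "2 * card (C \<inter> set ws) = length ws"
    and j: "j < length ws"
  shows "ws ! j \<in> C \<longleftrightarrow> ws ! (Suc j mod length ws) \<notin> C"
proof -
  let ?g = "\<lambda>j. of_bool (ws ! j \<in> C) + of_bool (ws ! (Suc j mod length ws) \<in> C) :: nat"
  have "1 = ?g j"
  proof (rule sum_mono_inv[where I = "{..<length ws}" and f = "\<lambda>_. 1" and g = ?g and i = j])
    show "(\<Sum>j<length ws. 1) = (\<Sum>j<length ws. ?g j)" using card_Int_cycle[OF ws, of C] eq by simp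
    fix j assume "j \<in> {..<length ws}"
    then have "cycle_edge ws j \<inter> C \<noteq> {}" using C cycle_edge_mem[OF ws] unfolding vcover_def by blast
    then show "1 \<le> ?g j" by (auto simp: cycle_edge_def)
  qed (use j in auto)
  then show ?thesis by (auto simp: of_bool_def split: if_splits)
qed

lemma cycle_invariant:
  assumes ws: "length ws \<ge> 1" and step: "\<And>j. j < length ws \<Longrightarrow> P (ws ! j) \<longleftrightarrow> P (ws ! (Suc j mod length ws))"
  shows "(\<forall>v\<in>set ws. P v) \<or> (\<forall>v\<in>set ws. \<not> P v)"
proof -
  have "P (ws ! j) \<longleftrightarrow> P (ws ! 0)" if "j < length ws" for j
    using that
  proof (induction j)
    case (Suc j)
    then show ?case using step[of j] by simp
  qed simp
  then show ?thesis by (metis in_set_conv_nth)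
qed

context bigraph
begin

lemma cycle_parity:
  assumes ws: "is_cycle E ws" and j: "j < length ws"
  shows "ws ! j \<in> A \<longleftrightarrow> (ws ! 0 \<in> A \<longleftrightarrow> even j)"
  using j
proof (induction j)
  case (Suc j)
  have "cycle_edge ws j \<in> E" using cycle_edge_mem[OF ws] Suc.prems by simp
  then have "ws ! j \<in> A \<longleftrightarrow> ws ! Suc j \<notin> A"
    using Suc.prems by (intro edge_neq) (simp add: cycle_edge_def)
  then show ?case using Suc by auto
qed simp

lemma cycle_even: 
  assumes ws: "is_cycle E ws"
  shows "even (length ws)" "4 \<le> length ws"
proof -
  have L: "3 \<le> length ws" using ws by (simp add: is_cycle_def)
  have "length ws - 1 < length ws" using L by linarith
  then have "cycle_edge ws (length ws - 1) \<in> E" by (rule cycle_edge_mem[OF ws])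
  moreover have "Suc (length ws - 1) = length ws" using L by simp
  ultimately have "{ws ! (length ws - 1), ws ! 0} \<in> E" by (simp add: cycle_edge_def)
  then have "ws ! (length ws - 1) \<in> A \<longleftrightarrow> ws ! 0 \<notin> A" by (rule edge_neq)
  moreover have "length ws - 1 < length ws" using L by linarith
  ultimately have "odd (length ws - 1)" using cycle_parity[OF ws] by blast
  then show "even (length ws)" using L by simp
  then show "4 \<le> length ws" using L by presburger
qed

lemma cycle_card_parts:
  assumes ws: "is_cycle E ws"
  shows "2 \<le> card A" "2 \<le> card B"
proof -
  have d: "distinct ws" using ws by (simp add: is_cycle_def)
  have L: "4 \<le> length ws" by (rule cycle_even[OF ws])
  then have "ws \<noteq> []" by auto
  have two: "2 \<le> card X" if "x \<in> X" "y \<in> X" "x \<noteq> y" for x y and X :: "'v set"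
    using card_mono[of X "{x, y}"] that by simp
  have n: "ws ! 0 \<noteq> ws ! 2" "ws ! 1 \<noteq> ws ! 3" using d L \<open>ws \<noteq> []\<close> by (simp_all add: nth_eq_iff_index_eq)
  have "(ws ! 2 \<in> A \<longleftrightarrow> ws ! 0 \<in> A) \<and> (ws ! 1 \<in> A \<longleftrightarrow> ws ! 0 \<notin> A) \<and> (ws ! 3 \<in> A \<longleftrightarrow> ws ! 0 \<notin> A)"
    using cycle_parity[OF ws, of 1] cycle_parity[OF ws, of 2] cycle_parity[OF ws, of 3] L by simp
  then show "2 \<le> card A" "2 \<le> card B"
    using two[OF _ _ n(1)] two[OF _ _ n(2)] by (cases "ws ! 0 \<in> A"; simp add: in_B_iff)+
qed

end

section \<open>Paths, and cycles through a given edge\<close>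

abbreviation adj :: "'v set set \<Rightarrow> ('v \<times> 'v) set" where
  "adj E \<equiv> {(a, b). {a, b} \<in> E}"

lemma rtrancl_simple_path:
  assumes "(u, w) \<in> (adj E)\<^sup>*"
  shows "\<exists>ws. distinct ws \<and> ws \<noteq> [] \<and> hd ws = u \<and> last ws = w \<and>
    (\<forall>j. Suc j < length ws \<longrightarrow> {ws ! j, ws ! Suc j} \<in> E)"
  using assms
proof (induction rule: rtrancl_induct)
  case base
  then show ?case by (intro exI[of _ "[u]"]) simp
next
  case (step y z)
  then obtain ws where ws: "distinct ws" "ws \<noteq> []" "hd ws = u" "last ws = y"
    "\<And>j. Suc j < length ws \<Longrightarrow> {ws ! j, ws ! Suc j} \<in> E" by blast
  show ?case
  proof (cases "z \<in> set ws")
    case True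
    then obtain xs ys where "ws = xs @ z # ys" by (auto simp: in_set_conv_decomp)
    then have eq: "ws = (xs @ [z]) @ ys" by simp
    have "{(xs @ [z]) ! j, (xs @ [z]) ! Suc j} \<in> E" if "Suc j < length (xs @ [z])" for j
    proof -
      have "ws ! k = (xs @ [z]) ! k" if "k < length (xs @ [z])" for k
        unfolding eq using that by (rule nth_append_left)
      moreover have "length (xs @ [z]) \<le> length ws" unfolding eq by simp
      ultimately show ?thesis using ws(5)[of j] that Suc_lessD[OF that] by (metis order_less_le_trans)
    qed
    moreover have "distinct (xs @ [z])" using ws(1) unfolding eq by simp
    moreover have "hd (xs @ [z]) = u" using ws(3) unfolding eq by (cases xs) simp_all
    ultimately show ?thesis by (intro exI[of _ "xs @ [z]"]) simp
  next
    case False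
    have "{(ws @ [z]) ! j, (ws @ [z]) ! Suc j} \<in> E" if "Suc j < length (ws @ [z])" for j
    proof (cases "Suc j < length ws")
      case True
      then show ?thesis using ws(5)[of j] by (simp add: nth_append)
    next
      case False
      then have "j = length ws - 1" using that by simp
      then show ?thesis using step.hyps(2) ws(2,4) by (simp add: nth_append last_conv_nth)
    qed
    then show ?thesis using False ws by (intro exI[of _ "ws @ [z]"]) simp
  qed
qed

text \<open>A simple path from \<open>u\<close> to \<open>v\<close> that avoids the edge has at
  least three vertices, so the edge closes it to a cycle.\<close>

lemma cycle_through_edge:
  assumes e: "{u, v} \<in> E" "u \<noteq> v" and conn: "(u, v) \<in> (adj (E - {{u, v}}))\<^sup>*"
  shows "\<exists>ws. is_cycle E ws \<and> {u, v} \<in> cycle_edges ws"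
proof -
  obtain ws where ws: "distinct ws" "ws \<noteq> []" "hd ws = u" "last ws = v"
    and path: "\<And>j. Suc j < length ws \<Longrightarrow> {ws ! j, ws ! Suc j} \<in> E - {{u, v}}"
    using rtrancl_simple_path[OF conn] by blast
  let ?L = "length ws"
  have h: "ws ! 0 = u" and l: "ws ! (?L - 1) = v"
    using ws by (simp_all add: hd_conv_nth last_conv_nth)
  have "?L \<noteq> 1" using h l e(2) by auto
  moreover have "?L \<noteq> 2" using path[of 0] h l by auto
  moreover have "?L \<noteq> 0" using ws by simp
  ultimately have L: "3 \<le> ?L" by linarith
  have S: "Suc (?L - 1) = ?L" and less: "?L - 1 < ?L" using L by linarith+
  have last: "cycle_edge ws (?L - 1) = {u, v}"
    unfolding cycle_edge_def S mod_self h l by (rule insert_commute)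
  have "{ws ! j, ws ! (Suc j mod ?L)} \<in> E" if j: "j < ?L" for j
  proof (cases "Suc j < ?L")
    case True
    then show ?thesis using path by simp
  next
    case False
    then have "j = ?L - 1" using j by simp
    then show ?thesis using last e(1) by (simp add: cycle_edge_def)
  qed
  then have "is_cycle E ws" using ws L by (simp add: is_cycle_def)
  moreover have "cycle_edge ws (?L - 1) \<in> cycle_edges ws"
    unfolding cycle_edges_def using less by simp
  ultimately show ?thesis unfolding last by blast
qed

section \<open>Connecting disjoint cycles\<close>

locale disjoint_cycles = thick_bigraph A B E for A B :: "'v::finite set" and E +
  fixes I :: "'i set" and vs :: "'i \<Rightarrow> 'v list"
  assumes conn: "(u, v) \<in> (adj E)\<^sup>*"
    and finite_I: "finite I" and I_nonempty: "I \<noteq> {}"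
    and cyc: "i \<in> I \<Longrightarrow> is_cycle E (vs i)"
    and disj: "i \<in> I \<Longrightarrow> j \<in> I \<Longrightarrow> i \<noteq> j \<Longrightarrow> set (vs i) \<inter> set (vs j) = {}"
begin

definition leaf :: "'v \<Rightarrow> bool" where
  "leaf v \<longleftrightarrow> card {e \<in> E. v \<in> e} = 1"

definition core :: "'v set" where
  "core = {v. \<not> leaf v}"

lemma leaf_unique:
  assumes "leaf v" "{v, x} \<in> E" "{v, y} \<in> E"
  shows "x = y"
proof -
  obtain e where e: "{e \<in> E. v \<in> e} = {e}" using assms(1) unfolding leaf_def by (rule card_1_singletonE)
  have "{v, x} \<in> {e \<in> E. v \<in> e}" "{v, y} \<in> {e \<in> E. v \<in> e}" using assms by simp_all
  then have "{v, x} = {v, y}" unfolding e by simp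
  then show ?thesis by (auto simp: doubleton_eq_iff)
qed

lemma non_leaf_other:
  assumes "v \<in> core" "{v, x} \<in> E"
  shows "\<exists>y. y \<noteq> x \<and> {v, y} \<in> E"
proof (rule ccontr)
  assume H: "\<not> ?thesis"
  have "{e \<in> E. v \<in> e} = {{v, x}}"
  proof
    show "{e \<in> E. v \<in> e} \<subseteq> {{v, x}}"
    proof
      fix e assume "e \<in> {e \<in> E. v \<in> e}"
      then have e: "e \<in> E" "v \<in> e" by auto
      then obtain y where "e = {v, y}" using edgeE[OF e(1)] by auto
      then show "e \<in> {{v, x}}" using H e by auto
    qed
  qed (use assms in auto)
  then show False using assms(1) by (simp add: core_def leaf_def)
qed

text \<open>By connectedness an edge with two leaves would be the whole graph, but there are at
  least four vertices.\<close>

lemma no_isolated_edge: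
  assumes "{u, v} \<in> E" "leaf u" shows "v \<in> core"
proof (rule ccontr)
  assume "v \<notin> core"
  then have "leaf v" by (simp add: core_def)
  have "w \<in> {u, v}" for w
    using conn[of u w]
  proof (induction rule: rtrancl_induct)
    case (step y z)
    have yz: "{y, z} \<in> E" using step by simp
    have vu: "{v, u} \<in> E" using assms(1) by (simp add: insert_commute)
    from step.IH consider "y = u" | "y = v" by blast
    then show ?case
    proof cases
      case 1
      then have "z = v" using leaf_unique[OF assms(2) _ assms(1)] yz by simp
      then show ?thesis by simp
    next
      case 2
      then have "z = u" using leaf_unique[OF \<open>leaf v\<close> _ vu] yz by simp
      then show ?thesis by simp
    qed
  qed simp
  then have "A \<union> B \<subseteq> {u, v}" by blast
  then have "card (A \<union> B) \<le> card {u, v}" by (intro card_mono) auto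
  also have "\<dots> \<le> 2" by (simp add: card_insert_if)
  finally show False using card_A card_B card_Un_disjoint[of A B] parts_Int by simp
qed

lemma cycle_subset_core: "i \<in> I \<Longrightarrow> set (vs i) \<subseteq> core"
  using cycle_two_neighbours[OF cyc] leaf_unique unfolding core_def by blast

lemma card_cycle: "i \<in> I \<Longrightarrow> card (set (vs i)) = length (vs i)"
  using cyc by (simp add: is_cycle_def distinct_card)

text \<open>The core is connected: without such an edge, \<open>X\<close> together with its attached
  leaves would be closed under adjacency.\<close>

lemma ex_boundary_edge:
  assumes X: "X \<subseteq> core" "X \<noteq> {}" "X \<noteq> core"
  shows "\<exists>x\<in>X. \<exists>y\<in>core - X. {x, y} \<in> E"
proof (rule ccontr)
  assume H: "\<not> ?thesis"
  define S where "S = X \<union> {v. leaf v \<and> (\<exists>x\<in>X. {v, x} \<in> E)}"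
  obtain x0 where x0: "x0 \<in> X" using X by blast
  have "w \<in> S" for w
    using conn[of x0 w]
  proof (induction rule: rtrancl_induct)
    case base
    then show ?case using x0 by (simp add: S_def)
  next
    case (step y z)
    then have yz: "{y, z} \<in> E" "{z, y} \<in> E" by (simp_all add: insert_commute)
    consider "y \<in> X" | x where "leaf y" "x \<in> X" "{y, x} \<in> E" using step.IH unfolding S_def by blast
    then show ?case
    proof cases
      case 1
      then have "z \<in> X \<or> leaf z" using H yz(1) unfolding core_def by blast
      then show ?thesis using 1 yz(2) unfolding S_def by blast
    next
      case 2
      then have "z = x" using leaf_unique[OF 2(1) yz(1) 2(3)] by simp
      then show ?thesis using 2 by (simp add: S_def)
    qed
  qed
  then have "core \<subseteq> X" unfolding S_def core_def by blast
  then show False using X by blast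
qed

text \<open>\<open>Q\<close> is a union of components of the hypergraph whose hyperedges are
  \<open>F\<close> and the vertex sets of the cycles.\<close>

definition block_sep :: "'v set set \<Rightarrow> 'v set \<Rightarrow> bool" where
  "block_sep F Q \<longleftrightarrow> (\<forall>e\<in>F. e \<subseteq> Q \<or> e \<inter> Q = {}) \<and> (\<forall>i\<in>I. set (vs i) \<subseteq> Q \<or> set (vs i) \<inter> Q = {})"

text \<open>Contracting every cycle in \<open>X\<close> to a point makes \<open>F\<close> a spanning
  tree of \<open>X\<close>: the cardinality equation is edges plus one equals vertices, and the last
  clause is connectedness, expressed by cuts because covers will be tested as cuts.\<close>

definition grown :: "'v set \<Rightarrow> 'v set set \<Rightarrow> bool" where
  "grown X F \<longleftrightarrow> X \<subseteq> core \<and> X \<noteq> {} \<and> F \<subseteq> E \<and>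
     (\<forall>e\<in>F. e \<subseteq> X \<and> (\<forall>i\<in>I. \<not> e \<subseteq> set (vs i))) \<and>
     (\<forall>i\<in>I. set (vs i) \<subseteq> X \<or> set (vs i) \<inter> X = {}) \<and>
     card F + (\<Sum>i\<in>{i\<in>I. set (vs i) \<subseteq> X}. length (vs i) - 1) + 1 = card X \<and>
     (\<forall>Q. block_sep F Q \<longrightarrow> X \<subseteq> Q \<or> X \<inter> Q = {})"

lemma cycle_nonempty: "i \<in> I \<Longrightarrow> set (vs i) \<noteq> {}"
  using cyc by (fastforce simp: is_cycle_def)

lemma grown_cycle:
  assumes i: "i \<in> I"
  shows "grown (set (vs i)) {}"
proof -
  have "j = i" if j: "j \<in> I" "set (vs j) \<subseteq> set (vs i)" for j
  proof (rule ccontr)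
    assume "j \<noteq> i"
    then have "set (vs j) \<inter> set (vs i) = {}" using disj j i by simp
    then show False using cycle_nonempty[OF j(1)] j(2) by (simp add: Int_absorb2)
  qed
  then have "{j \<in> I. set (vs j) \<subseteq> set (vs i)} = {i}" using i by auto
  moreover have "length (vs i) \<ge> 1" using cyc[OF i] by (simp add: is_cycle_def)
  ultimately have "card ({} :: 'v set set) + (\<Sum>j\<in>{j\<in>I. set (vs j) \<subseteq> set (vs i)}. length (vs j) - 1) + 1 = card (set (vs i))"
    by (simp add: card_cycle[OF i])
  moreover have "\<forall>j\<in>I. set (vs j) \<subseteq> set (vs i) \<or> set (vs j) \<inter> set (vs i) = {}"
  proof
    fix j assume "j \<in> I"
    then show "set (vs j) \<subseteq> set (vs i) \<or> set (vs j) \<inter> set (vs i) = {}"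
      using disj[of j i] i by (cases "j = i") simp_all
  qed
  ultimately show ?thesis
    unfolding grown_def block_sep_def using cycle_subset_core[OF i] cycle_nonempty[OF i] i by simp
qed

text \<open>\<open>Y\<close> is one vertex of the contracted graph, either a whole cycle or a vertex
  on no cycle; \<open>size\<close> makes it count as one point, so one new edge balances the
  equation.\<close>

lemma grown_step:
  assumes g: "grown X F" and Y: "Y \<subseteq> core" "Y \<inter> X = {}" and x: "x \<in> X" and y: "y \<in> Y" and e: "{x, y} \<in> E"
    and blocks: "\<forall>i\<in>I. set (vs i) \<subseteq> Y \<or> set (vs i) \<inter> Y = {}"
    and size: "(\<Sum>i\<in>{i\<in>I. set (vs i) \<subseteq> Y}. length (vs i) - 1) + 1 = card Y"
    and sepY: "\<And>Q. block_sep F Q \<Longrightarrow> Y \<subseteq> Q \<or> Y \<inter> Q = {}"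
  shows "grown (X \<union> Y) (insert {x, y} F)"
proof -
  have gX: "X \<subseteq> core" "X \<noteq> {}" "F \<subseteq> E"
    and gF: "\<forall>e\<in>F. e \<subseteq> X \<and> (\<forall>i\<in>I. \<not> e \<subseteq> set (vs i))"
    and bX: "\<forall>i\<in>I. set (vs i) \<subseteq> X \<or> set (vs i) \<inter> X = {}"
    and cX: "card F + (\<Sum>i\<in>{i\<in>I. set (vs i) \<subseteq> X}. length (vs i) - 1) + 1 = card X"
    and sX: "\<forall>Q. block_sep F Q \<longrightarrow> X \<subseteq> Q \<or> X \<inter> Q = {}"
    using g unfolding grown_def by - (elim conjE, assumption)+
  have yX: "y \<notin> X" and xY: "x \<notin> Y" using x y Y by blast+
  then have new: "{x, y} \<notin> F" using gF by blast
  have cF: "card (insert {x, y} F) = card F + 1" using new by simp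
  have split: "{i\<in>I. set (vs i) \<subseteq> X \<union> Y} = {i\<in>I. set (vs i) \<subseteq> X} \<union> {i\<in>I. set (vs i) \<subseteq> Y}"
    using bX blocks by blast
  have dis: "{i\<in>I. set (vs i) \<subseteq> X} \<inter> {i\<in>I. set (vs i) \<subseteq> Y} = {}"
  proof (rule ccontr)
    assume "\<not> ?thesis"
    then obtain i where i: "i \<in> I" "set (vs i) \<subseteq> X" "set (vs i) \<subseteq> Y" by blast
    then have "set (vs i) \<subseteq> Y \<inter> X" by simp
    then show False using Y(2) cycle_nonempty[OF i(1)] by simp
  qed
  have "(\<Sum>i\<in>{i\<in>I. set (vs i) \<subseteq> X \<union> Y}. length (vs i) - 1) =
      (\<Sum>i\<in>{i\<in>I. set (vs i) \<subseteq> X}. length (vs i) - 1) + (\<Sum>i\<in>{i\<in>I. set (vs i) \<subseteq> Y}. length (vs i) - 1)"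
    unfolding split by (rule sum.union_disjoint) (use finite_I dis in auto)
  moreover have "card (X \<union> Y) = card X + card Y"
    using Y(2) by (intro card_Un_disjoint) auto
  ultimately have card: "card (insert {x, y} F) + (\<Sum>i\<in>{i\<in>I. set (vs i) \<subseteq> X \<union> Y}. length (vs i) - 1) + 1 = card (X \<union> Y)"
    using cX size cF by linarith
  have notcyc: "\<not> {x, y} \<subseteq> set (vs i)" if "i \<in> I" for i
    using bspec[OF bX that] x yX by blast
  have bl: "set (vs i) \<subseteq> X \<union> Y \<or> set (vs i) \<inter> (X \<union> Y) = {}" if "i \<in> I" for i
    using bspec[OF bX that] bspec[OF blocks that] by blast
  have sep: "X \<union> Y \<subseteq> Q \<or> (X \<union> Y) \<inter> Q = {}" if Q: "block_sep (insert {x, y} F) Q" for Q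
  proof -
    have "block_sep F Q" and "{x, y} \<subseteq> Q \<or> {x, y} \<inter> Q = {}" using Q unfolding block_sep_def by simp_all
    then show ?thesis using sX sepY[of Q] x y by blast
  qed
  have "\<forall>e\<in>insert {x, y} F. e \<subseteq> X \<union> Y \<and> (\<forall>i\<in>I. \<not> e \<subseteq> set (vs i))"
    using gF x y notcyc by blast
  moreover have "X \<union> Y \<subseteq> core" "X \<union> Y \<noteq> {}" "insert {x, y} F \<subseteq> E"
    using gX Y(1) e by simp_all
  moreover have "\<forall>i\<in>I. set (vs i) \<subseteq> X \<union> Y \<or> set (vs i) \<inter> (X \<union> Y) = {}" using bl by simp
  moreover have "\<forall>Q. block_sep (insert {x, y} F) Q \<longrightarrow> X \<union> Y \<subseteq> Q \<or> (X \<union> Y) \<inter> Q = {}" using sep by simp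
  ultimately show ?thesis
    unfolding grown_def using card by (intro conjI) assumption+
qed

theorem connecting_edges:
  "\<exists>F. grown core F"
proof -
  obtain i0 where i0: "i0 \<in> I" using I_nonempty by blast
  have "\<exists>X. (\<exists>F. grown X F) \<and> (\<forall>X'. (\<exists>F. grown X' F) \<longrightarrow> card X' \<le> card X)"
  proof (rule Lattices_Big.ex_has_greatest_nat)
    show "\<exists>F. grown (set (vs i0)) F" using grown_cycle[OF i0] by (rule exI)
    show "\<forall>X. (\<exists>F. grown X F) \<longrightarrow> card X < Suc (card (UNIV :: 'v set))" by (simp add: less_Suc_eq_le card_mono)
  qed
  then obtain X F where F: "grown X F" and max: "\<And>X' F'. grown X' F' \<Longrightarrow> card X' \<le> card X" by auto
  have gX: "X \<subseteq> core" "X \<noteq> {}" and bX: "\<forall>i\<in>I. set (vs i) \<subseteq> X \<or> set (vs i) \<inter> X = {}"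
    using F unfolding grown_def by simp_all
  have "X = core"
  proof (rule ccontr)
    assume "X \<noteq> core"
    then obtain x y where xy: "x \<in> X" "y \<in> core" "y \<notin> X" "{x, y} \<in> E"
      using ex_boundary_edge[OF gX] by auto
    have "\<exists>X' F'. grown X' F' \<and> card X < card X'"
    proof (cases "\<exists>j\<in>I. y \<in> set (vs j)")
      case True
      then obtain j where j: "j \<in> I" "y \<in> set (vs j)" by blast
      have gj: "grown (set (vs j)) {}" by (rule grown_cycle[OF j(1)])
      have dj: "set (vs j) \<inter> X = {}" using bspec[OF bX j(1)] j(2) xy(3) by blast
      have "grown (X \<union> set (vs j)) (insert {x, y} F)"
      proof (rule grown_step[OF F cycle_subset_core[OF j(1)] dj xy(1) j(2) xy(4)])
        show "set (vs j) \<subseteq> Q \<or> set (vs j) \<inter> Q = {}" if "block_sep F Q" for Q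
          using that j(1) unfolding block_sep_def by simp
      qed (use gj in \<open>simp_all add: grown_def\<close>)
      moreover have "card X < card (X \<union> set (vs j))"
        using j xy by (intro psubset_card_mono) auto
      ultimately show ?thesis by blast
    next
      case False
      have "\<not> set (vs i) \<subseteq> {y}" if i: "i \<in> I" for i
      proof
        assume "set (vs i) \<subseteq> {y}"
        then have "y \<in> set (vs i)" using subset_singletonD cycle_nonempty[OF i] by fastforce
        then show False using False i by auto
      qed
      then have "{i \<in> I. set (vs i) \<subseteq> {y}} = {}" by auto
      have "grown (X \<union> {y}) (insert {x, y} F)"
      proof (rule grown_step[OF F _ _ xy(1) _ xy(4)])
        show "(\<Sum>i\<in>{i \<in> I. set (vs i) \<subseteq> {y}}. length (vs i) - 1) + 1 = card {y}"
          unfolding \<open>{i \<in> I. set (vs i) \<subseteq> {y}} = {}\<close> by simp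
      qed (use False xy in auto)
      moreover have "card X < card (X \<union> {y})" using xy by simp
      ultimately show ?thesis by blast
    qed
    then show False using max by (auto simp: not_le[symmetric])
  qed
  then show ?thesis using F by blast
qed

end

context disjoint_cycles
begin

lemma grown_coreD:
  assumes "grown core F"
  shows "F \<subseteq> E" "\<And>e. e \<in> F \<Longrightarrow> e \<subseteq> core" "\<And>e i. e \<in> F \<Longrightarrow> i \<in> I \<Longrightarrow> \<not> e \<subseteq> set (vs i)"
    "card F + (\<Sum>i\<in>I. length (vs i) - 1) + 1 = card core"
    "\<And>Q. block_sep F Q \<Longrightarrow> core \<subseteq> Q \<or> core \<inter> Q = {}"
proof -
  have "{i \<in> I. set (vs i) \<subseteq> core} = I" using cycle_subset_core by auto
  then show "card F + (\<Sum>i\<in>I. length (vs i) - 1) + 1 = card core"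
    using assms unfolding grown_def by simp
qed (use assms in \<open>simp_all add: grown_def\<close>)

section \<open>Existence of separating exponents\<close>

definition cycle_exponent :: "'v set set \<Rightarrow> 'v \<Rightarrow> nat" where
  "cycle_exponent F v = (\<Sum>i\<in>I. of_bool (v \<in> set (vs i))) + (\<Sum>e\<in>F. of_bool (v \<in> e))"

lemma sum_cycle_exponent:
  "sum (cycle_exponent F) C = (\<Sum>i\<in>I. card (C \<inter> set (vs i))) + (\<Sum>e\<in>F. card (C \<inter> e))"
proof -
  have 1: "(\<Sum>v\<in>C. of_bool (v \<in> X)) = card (C \<inter> X)" for X :: "'v set"
    by (simp add: Int_def)
  have "sum (cycle_exponent F) C = (\<Sum>i\<in>I. \<Sum>v\<in>C. of_bool (v \<in> set (vs i))) + (\<Sum>e\<in>F. \<Sum>v\<in>C. of_bool (v \<in> e))"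
    unfolding cycle_exponent_def sum.distrib by (subst (1 2) sum.swap) simp
  then show ?thesis unfolding 1 .
qed

lemma card_edge: "e \<in> E \<Longrightarrow> card e = 2"
  using edgeE parts_Int by (fastforce simp: card_2_iff)

lemma vcover_cycle_half: "vcover E C \<Longrightarrow> i \<in> I \<Longrightarrow> length (vs i) div 2 \<le> card (C \<inter> set (vs i))"
  using vcover_cycle_card[OF cyc, of i C] by linarith

lemma vcover_edge: "vcover E C \<Longrightarrow> e \<in> E \<Longrightarrow> 1 \<le> card (C \<inter> e)"
  unfolding vcover_def by (drule (1) bspec) (simp add: Suc_le_eq card_gt_0_iff inf.commute)

text \<open>A leaf has its only neighbour in the core and on the other side. If \<open>C\<close>
  omits that neighbour, it must contain the leaf.\<close>

lemma core_parts_determine: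
  assumes C: "vcover E C"
    and cases: "(\<forall>v\<in>core. v \<in> C \<longleftrightarrow> v \<in> A) \<or> (\<forall>v\<in>core. v \<in> C \<longleftrightarrow> v \<notin> A)"
  shows "A \<subseteq> C \<or> B \<subseteq> C"
proof -
  have nbr: "\<exists>w\<in>core. {v, w} \<in> E \<and> (v \<in> A \<longleftrightarrow> w \<notin> A) \<and> (v \<in> C \<or> w \<in> C)" if "v \<notin> core" for v
  proof -
    obtain w where w: "{v, w} \<in> E" using ex_nbr by auto
    have "leaf v" using that by (simp add: core_def)
    have "{v, w} \<inter> C \<noteq> {}" using C w unfolding vcover_def by (rule bspec)
    then have "v \<in> C \<or> w \<in> C" by auto
    then show ?thesis using no_isolated_edge[OF w \<open>leaf v\<close>] edge_neq[OF w] w by auto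
  qed
  from cases show ?thesis
  proof
    assume H: "\<forall>v\<in>core. v \<in> C \<longleftrightarrow> v \<in> A"
    have "v \<in> C" if "v \<in> A" for v
      using nbr[of v] H that by (cases "v \<in> core") auto
    then show ?thesis by auto
  next
    assume H: "\<forall>v\<in>core. v \<in> C \<longleftrightarrow> v \<notin> A"
    have "v \<in> C" if "v \<in> B" for v
      using nbr[of v] H that by (cases "v \<in> core") (auto simp: in_B_iff)
    then show ?thesis by auto
  qed
qed

theorem separating_exists:
  assumes F: "grown core F"
  shows "separating (cycle_exponent F) (card F + (\<Sum>i\<in>I. length (vs i) div 2))" (is "separating ?\<alpha> ?s")
proof -
  have s: "?s = (\<Sum>i\<in>I. length (vs i) div 2) + (\<Sum>e\<in>F. 1)" by simp
  have FE: "e \<in> E" if "e \<in> F" for e using that grown_coreD(1)[OF F] by auto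
  have low: "?s \<le> sum ?\<alpha> C" if "vcover E C" for C
    unfolding s sum_cycle_exponent using that FE
    by (intro add_mono sum_mono vcover_cycle_half vcover_edge) auto
  have "sum ?\<alpha> A + sum ?\<alpha> B = sum ?\<alpha> UNIV"
    using sum.union_disjoint[of A B ?\<alpha>] parts_Un parts_Int by simp
  also have "\<dots> = (\<Sum>i\<in>I. 2 * (length (vs i) div 2)) + (\<Sum>e\<in>F. 2)"
    unfolding sum_cycle_exponent
    by (intro arg_cong2[where f = plus] sum.cong refl) (simp_all add: card_cycle cycle_even(1)[OF cyc] card_edge[OF FE])
  also have "\<dots> = 2 * ?s" by (simp add: sum_distrib_left)
  finally have tot: "sum ?\<alpha> A + sum ?\<alpha> B = 2 * ?s" .
  \<comment> \<open>Both parts weigh at least \<open>?s\<close> as covers and together exactly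
    \<open>2 * ?s\<close>.\<close>
  have "x = z \<and> y = z" if "x + y = 2 * z" "z \<le> x" "z \<le> y" for x y z :: nat
    using that by linarith
  from this[OF tot low[OF vcover_parts(1)] low[OF vcover_parts(2)]]
  have AB: "sum ?\<alpha> A = ?s" "sum ?\<alpha> B = ?s" by simp_all
  have "A \<subseteq> C \<or> B \<subseteq> C" if C: "vcover E C" and le: "sum ?\<alpha> C \<le> ?s" for C
  proof -
    let ?c = "\<Sum>i\<in>I. card (C \<inter> set (vs i))" and ?h = "\<Sum>i\<in>I. length (vs i) div 2"
    have c: "?h \<le> ?c" by (intro sum_mono vcover_cycle_half C)
    have e: "(\<Sum>e\<in>F. 1) \<le> (\<Sum>e\<in>F. card (C \<inter> e))" by (intro sum_mono vcover_edge C FE)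
    \<comment> \<open>The lower bound is attained, so it is attained termwise: \<open>C\<close> is
      tight on every cycle and every edge of \<open>F\<close>.\<close>
    have "x = x' \<and> y = y'" if "x \<le> x'" "y \<le> y'" "x' + y' \<le> x + y" for x x' y y' :: nat
      using that by linarith
    from this[OF c e le[unfolded s sum_cycle_exponent]]
    have eqs: "?h = ?c" "(\<Sum>e\<in>F. 1) = (\<Sum>e\<in>F. card (C \<inter> e))" by simp_all
    have tc: "length (vs i) div 2 = card (C \<inter> set (vs i))" if "i \<in> I" for i
      by (rule sum_mono_inv[OF eqs(1) _ that finite_I]) (rule vcover_cycle_half[OF C])
    have te: "1 = card (C \<inter> e)" if "e \<in> F" for e
      by (rule sum_mono_inv[where f = "\<lambda>_. 1", OF eqs(2) _ that])
        (rule vcover_edge[OF C FE], assumption, rule finite)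
    \<comment> \<open>\<open>?Q\<close> is where \<open>C\<close> agrees with \<open>A\<close>.
      Along a tight edge or cycle membership in \<open>C\<close> alternates just as membership in
      \<open>A\<close> does, so \<open>?Q\<close> splits neither.\<close>
    let ?Q = "{v. v \<in> C \<longleftrightarrow> v \<in> A}"
    have "block_sep F ?Q"
      unfolding block_sep_def
    proof (intro conjI ballI)
      fix e assume e: "e \<in> F"
      obtain a b where ab: "a \<in> A" "b \<in> B" "e = {a, b}" using edgeE[OF FE[OF e]] by auto
      have "b \<notin> A" "a \<noteq> b" using ab parts_Int by auto
      have "\<not> (a \<in> C \<and> b \<in> C)"
      proof
        assume "a \<in> C \<and> b \<in> C"
        then have "C \<inter> e = {a, b}" using ab by auto
        then show False using te[OF e] \<open>a \<noteq> b\<close> by simp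
      qed
      moreover have "a \<in> C \<or> b \<in> C"
      proof (rule ccontr)
        assume "\<not> ?thesis"
        then have "C \<inter> e = {}" using ab by auto
        then show False using te[OF e] by simp
      qed
      ultimately show "e \<subseteq> ?Q \<or> e \<inter> ?Q = {}" using ab \<open>b \<notin> A\<close> by auto
    next
      fix i assume i: "i \<in> I"
      have tight: "2 * card (C \<inter> set (vs i)) = length (vs i)"
        using tc[OF i] cycle_even(1)[OF cyc[OF i]] by auto
      have "(\<forall>v\<in>set (vs i). v \<in> ?Q) \<or> (\<forall>v\<in>set (vs i). v \<notin> ?Q)"
      proof (rule cycle_invariant)
        show "length (vs i) \<ge> 1" using cyc[OF i] by (simp add: is_cycle_def)
        fix j assume j: "j < length (vs i)"
        have "vs i ! j \<in> C \<longleftrightarrow> vs i ! (Suc j mod length (vs i)) \<notin> C"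
          by (rule tight_vcover_cycle[OF cyc[OF i] C tight j])
        moreover have "vs i ! j \<in> A \<longleftrightarrow> vs i ! (Suc j mod length (vs i)) \<notin> A"
          using cycle_edge_mem[OF cyc[OF i] j] by (intro edge_neq) (simp add: cycle_edge_def)
        ultimately show "vs i ! j \<in> ?Q \<longleftrightarrow> vs i ! (Suc j mod length (vs i)) \<in> ?Q" by simp
      qed
      then show "set (vs i) \<subseteq> ?Q \<or> set (vs i) \<inter> ?Q = {}" by auto
    qed
    then have "core \<subseteq> ?Q \<or> core \<inter> ?Q = {}" by (rule grown_coreD(5)[OF F])
    then have "(\<forall>v\<in>core. v \<in> C \<longleftrightarrow> v \<in> A) \<or> (\<forall>v\<in>core. v \<in> C \<longleftrightarrow> v \<notin> A)" by auto
    then show ?thesis by (rule core_parts_determine[OF C])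
  qed
  then show ?thesis unfolding separating_def using AB by simp
qed

text \<open>Adding the indicator of an edge raises each cover by at least 1 and each part by exactly
  1. Hence the depth stays 1 once it has dropped.\<close>

lemma separating_Suc:
  assumes "separating \<alpha> s"
  shows "\<exists>\<alpha>'. separating \<alpha>' (Suc s)"
proof -
  obtain v0 w0 where "{v0, w0} \<in> E" using ex_nbr by blast
  then obtain a b where ab: "a \<in> A" "b \<in> B" "{a, b} \<in> E" using edgeE by metis
  have n: "a \<notin> B" "b \<notin> A" using ab parts_Int by auto
  define \<beta> where "\<beta> v = \<alpha> v + (of_bool (v = a) + of_bool (v = b))" for v
  have sum\<beta>: "sum \<beta> C = sum \<alpha> C + (of_bool (a \<in> C) + of_bool (b \<in> C))" for C
    unfolding \<beta>_def sum.distrib by (simp add: of_bool_def)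
  have "A \<subseteq> C \<or> B \<subseteq> C" if C: "vcover E C" "sum \<beta> C \<le> Suc s" for C
  proof -
    have "{a, b} \<inter> C \<noteq> {}" using C(1) ab(3) unfolding vcover_def by (rule bspec)
    then have "a \<in> C \<or> b \<in> C" by auto
    then have "sum \<alpha> C \<le> s" using C(2) unfolding sum\<beta> by auto
    then show ?thesis using assms C(1) unfolding separating_def by simp
  qed
  then have "separating \<beta> (Suc s)"
    using assms ab n unfolding separating_def sum\<beta> by simp
  then show ?thesis by (intro exI[of _ \<beta>])
qed

section \<open>Edges forced by a separating exponent\<close>

text \<open>The degrees of \<open>s\<close> edges add up to \<open>2 * s\<close>, the total weight
  of \<open>\<alpha>\<close>, so the Koenig list exhausts \<open>\<alpha>\<close>. A cover
  containing no listed edge entirely then weighs at most \<open>s\<close>.\<close>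

lemma separating_edges:
  assumes sep: "separating \<alpha> s"
  shows "\<exists>es. length es = s \<and> set es \<subseteq> E \<and>
    (\<forall>C. vcover E C \<longrightarrow> (\<forall>e\<in>set es. \<not> e \<subseteq> C) \<longrightarrow> A \<subseteq> C \<or> B \<subseteq> C)"
proof -
  have sA: "sum \<alpha> A = s" and sB: "sum \<alpha> B = s"
    and sC: "\<And>C. vcover E C \<Longrightarrow> sum \<alpha> C \<le> s \<Longrightarrow> A \<subseteq> C \<or> B \<subseteq> C"
    using sep unfolding separating_def by simp_all
  \<comment> \<open>A lighter cover would contain a part, which already weighs
    \<open>s\<close>.\<close>
  have "s \<le> sum \<alpha> C" if C: "vcover E C" for C
  proof (rule ccontr)
    assume "\<not> s \<le> sum \<alpha> C"
    then have lt: "sum \<alpha> C < s" by simp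
    then have "A \<subseteq> C \<or> B \<subseteq> C" using sC[OF C] by simp
    then have "sum \<alpha> A \<le> sum \<alpha> C \<or> sum \<alpha> B \<le> sum \<alpha> C" by (auto intro: sum_mono2)
    then show False using lt sA sB by simp
  qed
  from weighted_konig[OF this]
  obtain es where es: "length es = s" "set es \<subseteq> E"
    and le: "\<And>v. (\<Sum>e\<leftarrow>es. of_bool (v \<in> e)) \<le> \<alpha> v" by auto
  let ?d = "\<lambda>v. \<Sum>e\<leftarrow>es. of_bool (v \<in> e) :: nat"
  have ce: "card (e \<inter> UNIV) = 2" if "e \<in> set es" for e
    using that es(2) card_edge by auto
  have "sum ?d UNIV = (\<Sum>e\<leftarrow>es. card (e \<inter> UNIV))" by (rule sum_edge_degrees)
  also have "\<dots> = (\<Sum>e\<leftarrow>es. 2)" using ce by (intro arg_cong[where f = sum_list] map_cong) simp_all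
  also have "\<dots> = 2 * s" using es(1) by (simp add: sum_list_triv)
  also have "2 * s = sum \<alpha> UNIV"
    using sum.union_disjoint[of A B \<alpha>] parts_Un parts_Int sA sB by simp
  finally have eq: "sum ?d UNIV = sum \<alpha> UNIV" .
  have d: "?d v = \<alpha> v" for v
    by (rule sum_mono_inv[where f = ?d and g = \<alpha> and I = UNIV and i = v, OF eq le]) simp_all
  have "A \<subseteq> C \<or> B \<subseteq> C" if C: "vcover E C" and single: "\<And>e. e \<in> set es \<Longrightarrow> \<not> e \<subseteq> C" for C
  proof (rule sC[OF C])
    have one: "card (e \<inter> C) \<le> 1" if e: "e \<in> set es" for e
    proof -
      have "e \<inter> C \<subset> e" using single[OF e] by auto
      then have "card (e \<inter> C) < card e" by (rule psubset_card_mono[OF finite])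
      then show ?thesis using ce[OF e] by simp
    qed
    have "sum \<alpha> C = sum ?d C" unfolding d ..
    also have "\<dots> = (\<Sum>e\<leftarrow>es. card (e \<inter> C))" by (rule sum_edge_degrees)
    also have "\<dots> \<le> (\<Sum>e\<leftarrow>es. 1)" by (rule sum_list_mono) (rule one)
    also have "\<dots> = s" using es(1) by (simp add: sum_list_triv)
    finally show "sum \<alpha> C \<le> s" .
  qed
  then show ?thesis using es by (intro exI[of _ es]) simp
qed

end

lemma rtrancl_component_closed:
  assumes "(u, x) \<in> (adj E)\<^sup>*" "{x, y} \<in> E"
  shows "(u, y) \<in> (adj E)\<^sup>*"
  using assms(1) by (rule rtrancl_into_rtrancl) (use assms(2) in simp)

text \<open>Indices of cycle edges outside the forced set: two of opposite parity are cyclically adjacent.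
  The bound fails for \<open>L = 4\<close>, which is why cycles of length at least 6 are needed.\<close>

lemma adjacent_indices_bound:
  fixes Q :: "nat set"
  assumes L: "even L" "6 \<le> L" and Q: "Q \<subseteq> {..<L}"
    and near: "\<And>i j. i \<in> Q \<Longrightarrow> j \<in> Q \<Longrightarrow> i < j \<Longrightarrow> odd (j - i) \<Longrightarrow> j - i = 1 \<or> j - i = L - 1"
  shows "card Q \<le> L div 2"
proof -
  define P where "P c = {j \<in> Q. j mod 2 = c}" for c
  have finQ: "finite Q" by (rule finite_subset[OF Q]) simp
  have half: "card (P c) \<le> L div 2" if "c < 2" for c
  proof -
    have "P c \<subseteq> (\<lambda>k. 2 * k + c) ` {..<L div 2}"
    proof
      fix j assume "j \<in> P c"
      then have j: "j < L" "j mod 2 = c" using Q by (auto simp: P_def)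
      then have "j = 2 * (j div 2) + c" "j div 2 < L div 2" using L by presburger+
      then show "j \<in> (\<lambda>k. 2 * k + c) ` {..<L div 2}" by blast
    qed
    then have "card (P c) \<le> card ((\<lambda>k. 2 * k + c) ` {..<L div 2})" by (intro card_mono) auto
    also have "\<dots> \<le> L div 2" using card_image_le[of "{..<L div 2}"] by simp
    finally show ?thesis .
  qed
  have "Q = P 0 \<union> P 1" "P 0 \<inter> P 1 = {}" by (auto simp: P_def)
  then have card: "card Q = card (P 0) + card (P 1)"
    using card_Un_disjoint[of "P 0" "P 1"] finQ by (simp add: P_def)
  have lt: "c < L" if "c \<in> P k" for c k using that Q by (auto simp: P_def)
  have nbr: "d = c + 1 \<or> c = d + 1 \<or> c = 0 \<and> d + 1 = L"
    if c: "c \<in> P 0" and d: "d \<in> P 1" for c d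
  proof -
    have p: "c \<in> Q" "d \<in> Q" "even c" "odd d" using c d by (auto simp: P_def even_iff_mod_2_eq_zero odd_iff_mod_2_eq_one)
    then have "0 < d" by (cases d) auto
    from p consider "c < d" | "d < c" by (metis linorder_neqE_nat)
    then show ?thesis
    proof cases
      case 1
      then have "d - c = 1 \<or> d - c = L - 1" using near[OF p(1,2)] p by simp
      then show ?thesis using 1 lt[OF d] by linarith
    next
      case 2
      then have "c - d = 1 \<or> c - d = L - 1" using near[OF p(2,1)] p by simp
      then show ?thesis using 2 lt[OF c] \<open>0 < d\<close> by linarith
    qed
  qed
  show ?thesis
  proof (cases "P 0 = {} \<or> P 1 = {}")
    case True
    then show ?thesis using card half[of 0] half[of 1] by auto
  next
    case False
    then obtain c d where c: "c \<in> P 0" and d: "d \<in> P 1" by blast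
    have "P 1 \<subseteq> {c + 1, if c = 0 then L - 1 else c - 1}"
      using nbr[OF c] by fastforce
    then have "card (P 1) \<le> card {c + 1, if c = 0 then L - 1 else c - 1}" by (rule card_mono[rotated]) simp
    also have "\<dots> \<le> 2" by (simp add: card_insert_if)
    finally have two1: "card (P 1) \<le> 2" .
    have "P 0 \<subseteq> {d - 1, if d + 1 = L then 0 else d + 1}"
    proof
      fix c assume c: "c \<in> P 0"
      then show "c \<in> {d - 1, if d + 1 = L then 0 else d + 1}"
        using nbr[OF c d] lt[OF c] by (elim disjE) auto
    qed
    then have "card (P 0) \<le> card {d - 1, if d + 1 = L then 0 else d + 1}" by (rule card_mono[rotated]) simp
    also have "\<dots> \<le> 2" by (simp add: card_insert_if)
    finally have two0: "card (P 0) \<le> 2" .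
    \<comment> \<open>Two even and two odd indices, each adjacent to both of the other parity, would
      form a closed cycle of length 4 inside the index cycle of length \<open>L\<close>.\<close>
    have "\<not> (card (P 0) = 2 \<and> card (P 1) = 2)"
    proof
      assume "card (P 0) = 2 \<and> card (P 1) = 2"
      then obtain c c' d d' where P: "P 0 = {c, c'}" "P 1 = {d, d'}" and neq: "c \<noteq> c'" "d \<noteq> d'"
        by (auto simp: card_2_iff)
      then have m: "c \<in> P 0" "c' \<in> P 0" "d \<in> P 1" "d' \<in> P 1" by simp_all
      have two: "c + 1 = d \<and> c' = d + 1 \<or> c' + 1 = d \<and> c = d + 1 \<or>
          d + 1 = L \<and> c = 0 \<and> c' + 1 = d \<or> d + 1 = L \<and> c' = 0 \<and> c + 1 = d"
        if d: "d \<in> P 1" for d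
        using nbr[OF m(1) d] nbr[OF m(2) d] lt[OF m(1)] lt[OF m(2)] neq(1) by (elim disjE) auto
      show False
        using two[OF m(3)] two[OF m(4)] neq(2) L(2) by (elim disjE) auto
    qed
    then have "card Q \<le> 3" using card two0 two1 by linarith
    then show ?thesis using L by linarith
  qed
qed

section \<open>Covers that exchange the parts across a cut\<close>

context bigraph
begin

lemma cut_edge_in_A:
  assumes ME: "M \<subseteq> E"
    and forced: "\<And>C. vcover E C \<Longrightarrow> \<forall>e\<in>M. \<not> e \<subseteq> C \<Longrightarrow> A \<subseteq> C \<or> B \<subseteq> C"
    and cross: "\<And>x y. {x, y} \<in> E \<Longrightarrow> x \<in> T \<Longrightarrow> y \<notin> T \<Longrightarrow> x \<in> A"
    and b: "b \<in> B" "b \<in> T" and a: "a \<in> A" "a \<notin> T"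
  shows "\<exists>x\<in>T. \<exists>y. y \<notin> T \<and> {x, y} \<in> M"
proof (rule ccontr)
  assume H: "\<not> ?thesis"
  \<comment> \<open>This uses \<open>A\<close> inside \<open>T\<close> and \<open>B\<close> outside.
    It covers everything because edges leave \<open>T\<close> only from \<open>A\<close>, and the
    edges it contains entirely are exactly crossing ones.\<close>
  define C where "C = A \<inter> T \<union> (B - T)"
  have "vcover E C"
    unfolding vcover_iff
  proof (intro ballI impI)
    fix p q assume pq: "p \<in> A" "q \<in> B" "{p, q} \<in> E"
    show "p \<in> C \<or> q \<in> C"
    proof (rule ccontr)
      assume "\<not> ?thesis"
      then have "p \<notin> T" "q \<in> T" using pq by (auto simp: C_def)
      then have "q \<in> A" using cross[of q p] pq by (simp add: insert_commute)
      then show False using pq in_B_iff by simp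
    qed
  qed
  moreover have "\<not> e \<subseteq> C" if e: "e \<in> M" for e
  proof
    assume eC: "e \<subseteq> C"
    have "e \<in> E" using e ME by auto
    then obtain p q where pq: "p \<in> A" "q \<in> B" "e = {p, q}" using edgeE by metis
    then have "p \<in> T" "q \<notin> T" using eC parts_Int by (auto simp: C_def)
    then show False using H e pq by auto
  qed
  ultimately have "A \<subseteq> C \<or> B \<subseteq> C" using forced by simp
  moreover have "a \<notin> C" "b \<notin> C" using a b parts_Int by (auto simp: C_def)
  ultimately show False using a b by auto
qed

lemma cut_edge:
  assumes ME: "M \<subseteq> E"
    and forced: "\<And>C. vcover E C \<Longrightarrow> \<forall>e\<in>M. \<not> e \<subseteq> C \<Longrightarrow> A \<subseteq> C \<or> B \<subseteq> C"
    and cross: "\<And>x y. {x, y} \<in> E \<Longrightarrow> x \<in> T \<Longrightarrow> y \<notin> T \<Longrightarrow> x \<in> A \<longleftrightarrow> p"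
    and b: "b \<in> A \<longleftrightarrow> \<not> p" "b \<in> T" and a: "a \<in> A \<longleftrightarrow> p" "a \<notin> T"
  shows "\<exists>x\<in>T. \<exists>y. y \<notin> T \<and> {x, y} \<in> M"
proof (cases p)
  case True
  show ?thesis
    by (rule cut_edge_in_A[where a = a and b = b, OF ME forced]) (use True cross a b in_B_iff in simp_all)
next
  case False
  have forced': "B \<subseteq> C \<or> A \<subseteq> C" if "vcover E C" "\<forall>e\<in>M. \<not> e \<subseteq> C" for C
    using forced[OF that] by (elim disjE) simp_all
  show ?thesis
    by (rule bigraph.cut_edge_in_A[OF swap, where a = a and b = b, OF ME forced']) (use False cross a b in_B_iff in simp_all)
qed

end

text \<open>\<open>M\<close> is meant as the edge set of a Koenig list of a separating exponent, of
  which \<open>forced\<close> is the property used. Cycles are compared by edge sets since one cycle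
  has several vertex lists.\<close>

locale only_cycles = disjoint_cycles A B E I vs
  for A B :: "'v::finite set" and E and I :: "'i set" and vs +
  fixes M :: "'v set set"
  assumes only: "is_cycle E ws \<Longrightarrow> \<exists>i\<in>I. cycle_edges ws = cycle_edges (vs i)"
    and long: "i \<in> I \<Longrightarrow> 6 \<le> length (vs i)"
    and ME: "M \<subseteq> E"
    and forced: "vcover E C \<Longrightarrow> \<forall>e\<in>M. \<not> e \<subseteq> C \<Longrightarrow> A \<subseteq> C \<or> B \<subseteq> C"
begin

lemma bridge_forced:
  assumes e: "{x, y} \<in> E" and xy: "x \<in> core" "y \<in> core"
    and nc: "\<And>i. i \<in> I \<Longrightarrow> {x, y} \<notin> cycle_edges (vs i)"
  shows "{x, y} \<in> M"
proof -
  let ?E = "E - {{x, y}}"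
  define T where "T = {w. (x, w) \<in> (adj ?E)\<^sup>*}"
  have neq: "x \<noteq> y" using edge_neq[OF e] by auto
  have xT: "x \<in> T" by (simp add: T_def)
  have closed: "q \<in> T" if "p \<in> T" "{p, q} \<in> E" "{p, q} \<noteq> {x, y}" for p q
    using that rtrancl_component_closed[of x p ?E q] by (simp add: T_def)
  have yT: "y \<notin> T"
  proof
    assume "y \<in> T"
    then obtain ws where ws: "is_cycle E ws" "{x, y} \<in> cycle_edges ws"
      using cycle_through_edge[OF e neq] unfolding T_def by auto
    then show False using only[OF ws(1)] nc by auto
  qed
  have cross: "p = x \<and> q = y" if "{p, q} \<in> E" "p \<in> T" "q \<notin> T" for p q
    using closed[of p q] that yT by (auto simp: doubleton_eq_iff)
  \<comment> \<open>The edge is the only one leaving \<open>T\<close>. Since \<open>x\<close> and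
    \<open>y\<close> are not leaves, each has a further neighbour, and these witness that the
    exchanged cover contains neither part.\<close>
  obtain b where b: "b \<noteq> y" "{x, b} \<in> E" using non_leaf_other[OF xy(1) e] by auto
  have yx: "{y, x} \<in> E" using e by (simp add: insert_commute)
  obtain a where a: "a \<noteq> x" "{y, a} \<in> E" using non_leaf_other[OF xy(2) yx] by auto
  have bT: "b \<in> T" using closed[OF xT b(2)] b(1) neq by (auto simp: doubleton_eq_iff)
  have "{a, y} \<in> E" using a(2) by (simp add: insert_commute)
  then have aT: "a \<notin> T" using closed[of a y] yT a(1) by (auto simp: doubleton_eq_iff)
  have "\<exists>p\<in>T. \<exists>q. q \<notin> T \<and> {p, q} \<in> M"
  proof (rule cut_edge[OF ME forced, where p = "x \<in> A" and a = a and b = b])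
    show "p \<in> A \<longleftrightarrow> x \<in> A" if "{p, q} \<in> E" "p \<in> T" "q \<notin> T" for p q using cross[OF that] by simp
    show "b \<in> A \<longleftrightarrow> x \<notin> A" using edge_neq[OF b(2)] by auto
    show "a \<in> A \<longleftrightarrow> x \<in> A" using edge_neq[OF a(2)] edge_neq[OF e] by auto
  qed (use aT bT in simp_all)
  then obtain p q where pq: "p \<in> T" "q \<notin> T" "{p, q} \<in> M" by auto
  then have "{p, q} \<in> E" using ME by auto
  then show ?thesis using cross[of p q] pq by simp
qed

lemma cycle_edges_determine:
  assumes ij: "i \<in> I" "j \<in> I" and e: "e \<in> cycle_edges (vs i)" "e \<in> cycle_edges (vs j)"
  shows "i = j"
proof (rule ccontr)
  assume "i \<noteq> j"
  then have d: "set (vs i) \<inter> set (vs j) = {}" using disj ij by simp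
  have "e \<subseteq> set (vs i)" "e \<subseteq> set (vs j)"
    using e cycle_edge_subset_set unfolding cycle_edges_def by auto
  then have "e \<subseteq> {}" using d by auto
  moreover have "e \<noteq> {}" using e(1) by (auto simp: cycle_edges_def cycle_edge_def)
  ultimately show False by simp
qed

text \<open>Removing both edges cuts off an arc. As \<open>j - i\<close> is odd, both edges leave
  the arc from the same side of the bipartition, so \<open>cut_edge\<close> applies; the distance
  bounds provide its two witnesses.\<close>

lemma cycle_pair_forced:
  assumes k: "k \<in> I" and ij: "i < j" "j < length (vs k)" "odd (j - i)"
    and far: "3 \<le> j - i" "j - i + 3 \<le> length (vs k)"
  shows "cycle_edge (vs k) i \<in> M \<or> cycle_edge (vs k) j \<in> M"
proof -
  define ws where "ws = vs k"
  define L where "L = length ws"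
  have ws: "is_cycle E ws" unfolding ws_def by (rule cyc[OF k])
  have iL: "i < L" and jL: "j < L" using ij by (simp_all add: L_def ws_def)
  have nz: "ws \<noteq> []" using iL by (auto simp: L_def)
  let ?ei = "cycle_edge ws i" and ?ej = "cycle_edge ws j"
  define E' where "E' = E - {?ei, ?ej}"
  have edge: "{ws ! m, ws ! Suc m} \<in> E'" if "Suc m < L" "m \<noteq> i" "m \<noteq> j" for m
  proof -
    have "cycle_edge ws m \<in> E" using cycle_edge_mem[OF ws, of m] that by (simp add: L_def)
    moreover have "cycle_edge ws m \<noteq> ?ei" "cycle_edge ws m \<noteq> ?ej"
      using cycle_edge_inj[OF ws, of m i] cycle_edge_inj[OF ws, of m j] that iL jL by (auto simp: L_def)
    ultimately show ?thesis using that by (simp add: E'_def cycle_edge_def L_def)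
  qed
  have last_edge: "{ws ! (L - 1), ws ! 0} \<in> E'" if "j \<noteq> L - 1"
  proof -
    have "Suc (L - 1) = L" and m: "L - 1 < length ws" using iL unfolding L_def by linarith+
    then have m2: "Suc (L - 1) mod length ws = 0" by (simp add: L_def)
    have "cycle_edge ws (L - 1) \<in> E" by (rule cycle_edge_mem[OF ws m])
    moreover have "cycle_edge ws (L - 1) \<noteq> ?ei" "cycle_edge ws (L - 1) \<noteq> ?ej"
      using cycle_edge_inj[OF ws m, of i] cycle_edge_inj[OF ws m, of j] that iL jL ij(1) by (auto simp: L_def)
    ultimately show ?thesis unfolding E'_def cycle_edge_def m2 by simp
  qed
  define u where "u = ws ! Suc i"
  define T where "T = {w. (u, w) \<in> (adj E')\<^sup>*}"
  have closed: "q \<in> T" if "p \<in> T" "{p, q} \<in> E'" for p q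
    using that rtrancl_component_closed[of u p E' q] by (simp add: T_def)
  have closed': "p \<in> T" if "q \<in> T" "{p, q} \<in> E'" for p q
    using closed[of q p] that by (simp add: insert_commute)
  have ei: "?ei = {ws ! i, u}" using ij by (simp add: cycle_edge_def u_def L_def ws_def)
  have arc: "ws ! m \<in> T" if "Suc i \<le> m" "m \<le> j" for m
    using that
  proof (induction m rule: dec_induct)
    case base
    then show ?case by (simp add: T_def u_def)
  next
    case (step m)
    then show ?case using closed[of "ws ! m" "ws ! Suc m"] edge[of m] jL by simp
  qed
  \<comment> \<open>Otherwise there would be a cycle through \<open>?ei\<close> avoiding
    \<open>?ej\<close>, yet the only cycle through \<open>?ei\<close> is
    \<open>vs k\<close>.\<close>
  have iT: "ws ! i \<notin> T"
  proof
    assume "ws ! i \<in> T"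
    moreover have "E' = E - {?ej} - {{u, ws ! i}}"
      unfolding E'_def ei by (auto simp: insert_commute)
    ultimately have conn': "(u, ws ! i) \<in> (adj (E - {?ej} - {{u, ws ! i}}))\<^sup>*"
      unfolding T_def by simp
    have "?ei \<in> E" using cycle_edge_mem[OF ws] iL by (simp add: L_def)
    moreover have "?ei \<noteq> ?ej" using cycle_edge_inj[OF ws, of i j] iL jL ij(1) by (auto simp: L_def)
    ultimately have e: "{u, ws ! i} \<in> E - {?ej}" by (simp add: ei insert_commute)
    have "u \<noteq> ws ! i" using edge_neq[of u "ws ! i"] e by auto
    from cycle_through_edge[OF e this conn'] obtain xs
      where xs: "is_cycle (E - {?ej}) xs" "{u, ws ! i} \<in> cycle_edges xs" by auto
    then have "is_cycle E xs" by (simp add: is_cycle_def)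
    then obtain l where l: "l \<in> I" "cycle_edges xs = cycle_edges (vs l)" using only by auto
    have "?ei \<in> cycle_edges (vs k)" using iL by (simp add: cycle_edges_def ws_def L_def)
    moreover have "?ei \<in> cycle_edges (vs l)" using xs(2) l(2) by (simp add: ei insert_commute)
    ultimately have "l = k" using cycle_edges_determine[OF l(1) k] by simp
    then have "?ej \<in> cycle_edges xs" using l(2) jL by (simp add: cycle_edges_def ws_def L_def)
    then show False using cycle_edges_subset[OF xs(1)] by auto
  qed
  have below: "ws ! m \<notin> T" if "m \<le> i" for m
    using that
  proof (induction m rule: inc_induct)
    case base
    then show ?case by (rule iT)
  next
    case (step m)
    then show ?case using closed[of "ws ! m" "ws ! Suc m"] edge[of m] iL ij(1) by auto
  qed
  have above: "ws ! m \<notin> T" if "j < m" "m < L" for m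
  proof -
    have "m \<le> L - 1" using that by simp
    then show ?thesis using that(1)
    proof (induction m rule: inc_induct)
      case base
      then show ?case using closed[of "ws ! (L - 1)" "ws ! 0"] last_edge below[of 0] by auto
    next
      case (step m)
      then show ?case using closed[of "ws ! m" "ws ! Suc m"] edge[of m] ij(1) by auto
    qed
  qed
  have next_j: "ws ! (Suc j mod L) \<notin> T"
    using below[of 0] above[of "Suc j"] jL by (cases "Suc j = L") auto
  have ej: "?ej = {ws ! j, ws ! (Suc j mod L)}" by (simp add: cycle_edge_def L_def)
  have par: "ws ! m \<in> A \<longleftrightarrow> (ws ! 0 \<in> A \<longleftrightarrow> even m)" if "m < L" for m
    using cycle_parity[OF ws] that by (simp add: L_def)
  have evenL: "even L" unfolding L_def by (rule cycle_even[OF ws])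
  have far': "3 \<le> j - i" "j - i + 3 \<le> L" using far by (simp_all add: L_def ws_def)
  have cross: "({p, q} = ?ei \<or> {p, q} = ?ej) \<and> (p \<in> A \<longleftrightarrow> u \<in> A)"
    if pq: "{p, q} \<in> E" "p \<in> T" "q \<notin> T" for p q
  proof -
    have "{p, q} = ?ei \<or> {p, q} = ?ej"
    proof (rule ccontr)
      assume "\<not> ?thesis"
      then have "{p, q} \<in> E'" using pq by (simp add: E'_def)
      then show False using closed pq by simp
    qed
    then show ?thesis
    proof
      assume e: "{p, q} = ?ei"
      then have "p = u" using iT pq unfolding ei by (auto simp: doubleton_eq_iff)
      then show ?thesis using e by simp
    next
      assume e: "{p, q} = ?ej"
      then have "p = ws ! j" using next_j pq unfolding ej by (auto simp: doubleton_eq_iff)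
      moreover have "ws ! j \<in> A \<longleftrightarrow> u \<in> A"
        using par[OF jL] par[of "Suc i"] ij iL jL by (auto simp: u_def)
      ultimately show ?thesis using e by simp
    qed
  qed
  \<comment> \<open>The cyclic predecessor of position \<open>i\<close> lies outside
    \<open>T\<close> on the side of \<open>u\<close>; the successor of \<open>u\<close> lies inside
    on the other side.\<close>
  define a where "a = (if i = 0 then ws ! (L - 1) else ws ! (i - 1))"
  define b where "b = ws ! Suc (Suc i)"
  have "\<exists>p\<in>T. \<exists>q. q \<notin> T \<and> {p, q} \<in> M"
  proof (rule cut_edge[OF ME forced, where p = "u \<in> A" and a = a and b = b])
    show "p \<in> A \<longleftrightarrow> u \<in> A" if "{p, q} \<in> E" "p \<in> T" "q \<notin> T" for p q using cross[OF that] by simp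
    show "b \<in> T" unfolding b_def using far' by (intro arc) simp_all
    show "b \<in> A \<longleftrightarrow> u \<notin> A"
      using par[of "Suc (Suc i)"] par[of "Suc i"] far' jL by (auto simp: b_def u_def)
    show "a \<notin> T"
    proof (cases "i = 0")
      case True
      then show ?thesis using above[of "L - 1"] far' by (simp add: a_def)
    next
      case False
      then show ?thesis using below[of "i - 1"] by (simp add: a_def)
    qed
    show "a \<in> A \<longleftrightarrow> u \<in> A"
    proof (cases "i = 0")
      case True
      then show ?thesis using par[of "L - 1"] par[of "Suc i"] far' evenL by (auto simp: a_def u_def)
    next
      case False
      then show ?thesis using par[of "i - 1"] par[of "Suc i"] far' jL iL by (auto simp: a_def u_def)
    qed
  qed
  then obtain p q where pq: "p \<in> T" "q \<notin> T" "{p, q} \<in> M" by auto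
  then have "{p, q} \<in> E" using ME by auto
  then show ?thesis using cross[of p q] pq by (auto simp: ws_def)
qed

lemma cycle_edges_forced:
  assumes k: "k \<in> I"
  shows "length (vs k) div 2 \<le> card (cycle_edges (vs k) \<inter> M)"
proof -
  let ?L = "length (vs k)" and ?c = "cycle_edge (vs k)"
  define Q where "Q = {j \<in> {..<?L}. ?c j \<notin> M}"
  have evenL: "even ?L" by (rule cycle_even[OF cyc[OF k]])
  have "card Q \<le> ?L div 2"
  proof (rule adjacent_indices_bound[OF evenL long[OF k]])
    show "Q \<subseteq> {..<?L}" by (auto simp: Q_def)
    fix i j assume ij: "i \<in> Q" "j \<in> Q" "i < j" "odd (j - i)"
    \<comment> \<open>For even length an odd distance outside the range from 3 to
      \<open>?L - 3\<close> is 1 or \<open>?L - 1\<close>.\<close>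
    then have "\<not> (3 \<le> j - i \<and> j - i + 3 \<le> ?L)"
      using cycle_pair_forced[OF k ij(3) _ ij(4)] by (auto simp: Q_def)
    moreover have "j < ?L" using ij by (simp add: Q_def)
    ultimately show "j - i = 1 \<or> j - i = ?L - 1" using ij(3,4) evenL by presburger
  qed
  moreover have "card ({..<?L} - Q) = ?L - card Q"
    by (subst card_Diff_subset) (auto simp: Q_def)
  moreover have "card ({..<?L} - Q) = card (?c ` ({..<?L} - Q))"
    by (rule card_image[symmetric]) (auto intro!: inj_onI cycle_edge_inj[OF cyc[OF k]])
  moreover have "card (?c ` ({..<?L} - Q)) \<le> card (cycle_edges (vs k) \<inter> M)"
    by (rule card_mono) (auto simp: Q_def cycle_edges_def)
  ultimately show ?thesis using evenL by linarith
qed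

text \<open>The edges of \<open>F\<close> join core vertices and lie on no cycle, so they are
  bridges and forced; the forced halves of the disjoint cycles come on top.\<close>

theorem forced_edges_bound:
  assumes F: "grown core F"
  shows "card F + (\<Sum>i\<in>I. length (vs i) div 2) \<le> card M"
proof -
  let ?D = "\<lambda>i. cycle_edges (vs i) \<inter> M"
  have FM: "F \<subseteq> M"
  proof
    fix e assume e: "e \<in> F"
    then have "e \<in> E" using grown_coreD(1)[OF F] by auto
    then obtain x y where xy: "e = {x, y}" using edgeE by metis
    have "e \<notin> cycle_edges (vs i)" if "i \<in> I" for i
      using grown_coreD(3)[OF F e that] cycle_edge_subset_set by (auto simp: cycle_edges_def)
    then show "e \<in> M"
      using grown_coreD(2)[OF F e] \<open>e \<in> E\<close> unfolding xy by (intro bridge_forced) auto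
  qed
  have dis: "F \<inter> (\<Union>i\<in>I. ?D i) = {}"
  proof -
    have "\<not> e \<in> cycle_edges (vs i)" if "e \<in> F" "i \<in> I" for e i
      using grown_coreD(3)[OF F that] cycle_edge_subset_set by (auto simp: cycle_edges_def)
    then show ?thesis by auto
  qed
  have "card F + (\<Sum>i\<in>I. length (vs i) div 2) \<le> card F + (\<Sum>i\<in>I. card (?D i))"
    by (intro add_left_mono sum_mono cycle_edges_forced)
  also have "(\<Sum>i\<in>I. card (?D i)) = card (\<Union>i\<in>I. ?D i)"
  proof (rule card_UN_disjoint[symmetric, OF finite_I])
    show "\<forall>i\<in>I. \<forall>j\<in>I. i \<noteq> j \<longrightarrow> ?D i \<inter> ?D j = {}"
      using cycle_edges_determine by auto
  qed simp
  also have "card F + \<dots> = card (F \<union> (\<Union>i\<in>I. ?D i))"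
    by (rule card_Un_disjoint[symmetric]) (use dis in auto)
  also have "\<dots> \<le> card M" by (rule card_mono) (use FM in auto)
  finally show ?thesis .
qed

end

context disjoint_cycles
begin

section \<open>The index of depth stability\<close>

text \<open>Leaf edges correspond to leaves, since no edge joins two leaves.\<close>

lemma card_core: "card core + card {e \<in> E. \<exists>v\<in>e. leaf v} = card (UNIV :: 'v set)"
proof -
  define ed where "ed v = {v, SOME w. {v, w} \<in> E}" for v
  have ed: "ed v \<in> E" for v
    unfolding ed_def by (rule someI_ex[OF ex_nbr])
  have "inj_on ed {v. leaf v}"
  proof (rule inj_onI, rule ccontr)
    fix u v assume uv: "u \<in> {v. leaf v}" "v \<in> {v. leaf v}" "ed u = ed v" "u \<noteq> v"
    have "u \<in> ed u" "v \<in> ed v" by (simp_all add: ed_def)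
    then have "ed u = {u, v}" using uv by (auto simp: ed_def)
    then have "{u, v} \<in> E" using ed[of u] by simp
    then show False using no_isolated_edge uv by (simp add: core_def)
  qed
  moreover have "ed ` {v. leaf v} = {e \<in> E. \<exists>v\<in>e. leaf v}"
  proof
    show "ed ` {v. leaf v} \<subseteq> {e \<in> E. \<exists>v\<in>e. leaf v}"
      using ed by (auto simp: ed_def)
    show "{e \<in> E. \<exists>v\<in>e. leaf v} \<subseteq> ed ` {v. leaf v}"
    proof
      fix e assume "e \<in> {e \<in> E. \<exists>v\<in>e. leaf v}"
      then obtain v where v: "e \<in> E" "v \<in> e" "leaf v" by auto
      then obtain w where w: "e = {v, w}" using edgeE[OF v(1)] by auto
      have "w = (SOME w. {v, w} \<in> E)"
        by (rule leaf_unique[OF v(3)]) (use v w ed[of v] in \<open>simp_all add: ed_def\<close>)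
      then have "e = ed v" by (simp add: w ed_def)
      then show "e \<in> ed ` {v. leaf v}" using v by simp
    qed
  qed
  ultimately have "card {e \<in> E. \<exists>v\<in>e. leaf v} = card {v. leaf v}"
    using card_image by metis
  moreover have "card core + card {v. leaf v} = card (core \<union> {v. leaf v})"
    by (rule card_Un_disjoint[symmetric]) (auto simp: core_def)
  moreover have "core \<union> {v. leaf v} = UNIV" by (auto simp: core_def)
  ultimately show ?thesis by simp
qed

lemma separating_from:
  assumes "grown core F" "card F + (\<Sum>i\<in>I. length (vs i) div 2) \<le> s"
  shows "\<exists>\<alpha>. separating \<alpha> s"
  using assms(2)
proof (induction s rule: dec_induct)
  case base
  show ?case using separating_exists[OF assms(1)] by (intro exI)
next
  case (step s)
  then obtain \<alpha> where "separating \<alpha> s" by (elim exE)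
  then show ?case by (rule separating_Suc)
qed

text \<open>The tree count in \<open>grown\<close> eliminates \<open>card F\<close>; each cycle
  contributes \<open>- (length - 1) + length / 2\<close>, whence the term
  \<open>card I\<close>.\<close>

lemma real_stability_index:
  assumes F: "grown core F"
  shows "real (Suc (card F + (\<Sum>i\<in>I. length (vs i) div 2))) =
    real (card (UNIV :: 'v set)) - real (card {e \<in> E. \<exists>v\<in>e. leaf v})
      - (\<Sum>i\<in>I. real (length (vs i))) / 2 + real (card I)"
proof -
  have "real (length (vs i) div 2) = real (length (vs i)) / 2" if "i \<in> I" for i
    using cycle_even(1)[OF cyc[OF that]] by (auto elim!: evenE)
  then have half: "real (\<Sum>i\<in>I. length (vs i) div 2) = (\<Sum>i\<in>I. real (length (vs i))) / 2"
    unfolding of_nat_sum sum_divide_distrib by (intro sum.cong refl)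
  have "real (length (vs i) - 1) = real (length (vs i)) - 1" if "i \<in> I" for i
    using cycle_even(2)[OF cyc[OF that]] by (simp add: of_nat_diff)
  then have "real (\<Sum>i\<in>I. length (vs i) - 1) = (\<Sum>i\<in>I. real (length (vs i)) - 1)"
    unfolding of_nat_sum by (intro sum.cong refl)
  then have "real (\<Sum>i\<in>I. length (vs i) - 1) = (\<Sum>i\<in>I. real (length (vs i))) - real (card I)"
    by (simp only: sum_subtractf) simp
  moreover have "real (card F) + real (\<Sum>i\<in>I. length (vs i) - 1) + 1 = real (card core)"
    unfolding grown_coreD(4)[OF F, symmetric] by simp
  moreover have "real (card core) + real (card {e \<in> E. \<exists>v\<in>e. leaf v}) = real (card (UNIV :: 'v set))"
    using card_core by (simp flip: of_nat_add)
  ultimately show ?thesis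
    unfolding of_nat_Suc of_nat_add half by (simp add: field_simps)
qed

end

section \<open>Cycle subgraphs as vertex lists, and the final count\<close>

lemma is_cycle_of_obtain:
  assumes "is_cycle_of D G"
  shows "\<exists>ws. is_cycle (edges G) ws \<and> verts D = set ws \<and> edges D = cycle_edges ws"
proof -
  obtain ws where ws: "length ws \<ge> 3" "distinct ws" "verts D = set ws"
    "edges D = {{ws ! i, ws ! (Suc i mod length ws)} | i. i < length ws}" and sub: "edges D \<subseteq> edges G"
    using assms unfolding is_cycle_of_def by auto
  have "edges D = cycle_edges ws"
    unfolding ws(4) cycle_edges_def cycle_edge_def by auto
  moreover have "is_cycle (edges G) ws"
    using ws(1,2) sub unfolding is_cycle_def ws(4) by auto
  ultimately show ?thesis using ws(3) by auto
qed

lemma is_cycle_of_cycle_edges: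
  assumes "is_cycle (edges G) ws" "verts G = UNIV"
  shows "is_cycle_of (set ws, cycle_edges ws) G"
proof -
  have "cycle_edges ws = {{ws ! i, ws ! (Suc i mod length ws)} | i. i < length ws}"
    unfolding cycle_edges_def cycle_edge_def by auto
  then show ?thesis
    using assms cycle_edges_subset[OF assms(1)] unfolding is_cycle_of_def is_cycle_def
    by (intro conjI exI[of _ ws]) simp_all
qed

theorem theorem4p7:
  fixes G :: "'v::finite ugraph" and C :: "nat \<Rightarrow> 'v ugraph" and r :: nat
    and I :: "('v, 'k::field) mpoly set"
  assumes "verts G = UNIV" and "simple_graph G" and "connected_graph G" and "bipartite G"
    and "I = edge_ideal G"
    and "r \<ge> 1"
    and "\<And>i. i \<in> {1..r} \<Longrightarrow> is_cycle_of (C i) G"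
    and "\<And>i j. i \<in> {1..r} \<Longrightarrow> j \<in> {1..r} \<Longrightarrow> i \<noteq> j \<Longrightarrow> verts (C i) \<inter> verts (C j) = {}"
  shows "real (dstab I) \<le> real (num_verts G) - real (num_leaf_edges G)
           - (\<Sum>i=1..r. real (num_verts (C i))) / 2 + real r \<and>
         ((\<forall>D. is_cycle_of D G \<longrightarrow> (\<exists>i\<in>{1..r}. D = C i)) \<and>
          (\<forall>i\<in>{1..r}. num_verts (C i) \<ge> 6) \<longrightarrow>
          real (dstab I) = real (num_verts G) - real (num_leaf_edges G)
           - (\<Sum>i=1..r. real (num_verts (C i))) / 2 + real r)"
proof -
  define E where "E = edges G"
  obtain A B where "A \<union> B = UNIV" "A \<inter> B = {}" "\<forall>e\<in>E. \<exists>a\<in>A. \<exists>b\<in>B. e = {a, b}"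
    using assms(1,4) unfolding bipartite_def E_def by auto
  then interpret bigraph A B E by unfold_locales simp_all
  define vs where "vs i = (SOME ws. is_cycle E ws \<and> verts (C i) = set ws \<and> edges (C i) = cycle_edges ws)" for i
  have vs: "is_cycle E (vs i) \<and> verts (C i) = set (vs i) \<and> edges (C i) = cycle_edges (vs i)" if "i \<in> {1..r}" for i
    unfolding vs_def E_def by (rule someI_ex[OF is_cycle_of_obtain[OF assms(7)[OF that]]])
  have c1: "is_cycle E (vs 1)" using vs[of 1] assms(6) by simp
  have conn: "(u, v) \<in> (adj E)\<^sup>*" for u v
    using assms(1,3) by (simp add: connected_graph_def E_def)
  have nbr: "\<exists>w. {v, w} \<in> E" for v
  proof -
    have "\<exists>w. w \<noteq> v"
    proof (rule ccontr)
      assume "\<not> ?thesis"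
      then have "A \<subseteq> {v}" by auto
      then have "card A \<le> card {v}" by (rule card_mono[rotated]) simp
      then show False using cycle_card_parts(1)[OF c1] by simp
    qed
    then obtain w where "w \<noteq> v" by auto
    then show ?thesis using conn[of v w] by (auto elim: converse_rtranclE)
  qed
  interpret disjoint_cycles A B E "{1..r}" vs
  proof unfold_locales
    show "set (vs i) \<inter> set (vs j) = {}" if "i \<in> {1..r}" "j \<in> {1..r}" "i \<noteq> j" for i j
      using assms(8)[OF that] vs[OF that(1)] vs[OF that(2)] by simp
  qed (use cycle_card_parts[OF c1] nbr conn vs assms(6) in auto)
  obtain F where F: "grown core F" using connecting_edges by auto
  define s where "s = card F + (\<Sum>i\<in>{1..r}. length (vs i) div 2)"
  have nv: "num_verts (C i) = length (vs i)" if "i \<in> {1..r}" for i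
    using vs[OF that] card_cycle[OF that] by (simp add: num_verts_def)
  have "num_leaf_edges G = card {e \<in> E. \<exists>v\<in>e. leaf v}"
    unfolding num_leaf_edges_def vertex_degree_def leaf_def by (simp only: E_def)
  then have bound: "real (num_verts G) - real (num_leaf_edges G)
      - (\<Sum>i=1..r. real (num_verts (C i))) / 2 + real r = real (Suc s)"
    unfolding s_def real_stability_index[OF F] using nv assms(1) by (simp add: num_verts_def)
  have pow: "ideal_power I t = monomial_ideal (cover_exps t)" for t
    unfolding assms(5) by (rule ideal_power_edge_ideal) (rule E_def[symmetric])
  \<comment> \<open>A cover is light for the power \<open>t\<close> if its weight is at most
    \<open>t - 1\<close>, so an exponent separating for \<open>s\<close> acts first at the power
    \<open>Suc s\<close>.\<close>
  have depth1: "depth_quot (ideal_power I t) = 1" if t: "t \<ge> Suc s" for t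
  proof -
    have "s \<le> t - 1" using t by simp
    then obtain \<alpha> where "separating \<alpha> (t - 1)" using separating_from[OF F] unfolding s_def by auto
    moreover have "t \<ge> 1" using t by simp
    ultimately show ?thesis unfolding pow by (intro depth_quot_eq_1)
  qed
  let ?P = "\<lambda>s. s \<ge> 1 \<and> (\<forall>t\<ge>s. depth_quot (ideal_power I t) = depth_quot (ideal_power I s))"
  have P: "?P (Suc s)" using depth1 by simp
  have le: "dstab I \<le> Suc s" unfolding dstab_def by (rule Least_le) (rule P)
  have "dstab I = Suc s"
    if only: "\<forall>D. is_cycle_of D G \<longrightarrow> (\<exists>i\<in>{1..r}. D = C i)" and long: "\<forall>i\<in>{1..r}. num_verts (C i) \<ge> 6"
  proof (rule ccontr)
    assume "dstab I \<noteq> Suc s"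
    then have lt: "dstab I \<le> s" using le by simp
    have "?P (dstab I)" unfolding dstab_def by (rule LeastI) (rule P)
    then have d1: "1 \<le> dstab I" and "\<forall>t\<ge>dstab I. depth_quot (ideal_power I t) = depth_quot (ideal_power I (dstab I))"
      by (rule conjunct1, rule conjunct2)
    \<comment> \<open>Stability already at \<open>s\<close> would carry the depth 1 of the power
      \<open>Suc s\<close> down to the power \<open>s\<close>.\<close>
    then have "depth_quot (ideal_power I s) = depth_quot (ideal_power I (Suc s))" using lt le by metis
    then have "depth_quot (ideal_power I s) = 1" using depth1[of "Suc s"] by simp
    moreover have s1: "1 \<le> s" using d1 lt by simp
    \<comment> \<open>Such an exponent would list \<open>s - 1\<close> edges, among them at least
      \<open>s\<close> distinct forced ones.\<close>
    have "\<not> (\<exists>\<alpha>. separating \<alpha> (s - 1))"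
    proof
      assume "\<exists>\<alpha>. separating \<alpha> (s - 1)"
      then obtain es where es: "length es = s - 1" "set es \<subseteq> E"
        and forced: "\<And>C. vcover E C \<Longrightarrow> \<forall>e\<in>set es. \<not> e \<subseteq> C \<Longrightarrow> A \<subseteq> C \<or> B \<subseteq> C"
        using separating_edges by metis
      interpret only_cycles A B E "{1..r}" vs "set es"
      proof unfold_locales
        show "\<exists>i\<in>{1..r}. cycle_edges ws = cycle_edges (vs i)" if ws: "is_cycle E ws" for ws
        proof -
          have "is_cycle_of (set ws, cycle_edges ws) G"
            using is_cycle_of_cycle_edges ws assms(1) unfolding E_def by blast
          then obtain i where i: "i \<in> {1..r}" "(set ws, cycle_edges ws) = C i" using only by blast
          then have "cycle_edges ws = edges (C i)" by (metis snd_conv)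
          then show ?thesis using vs[OF i(1)] i(1) by auto
        qed
        show "6 \<le> length (vs i)" if "i \<in> {1..r}" for i
          using bspec[OF long that] unfolding nv[OF that] .
      qed (use es forced in simp_all)
      have "s \<le> card (set es)" unfolding s_def by (rule forced_edges_bound[OF F])
      also have "\<dots> \<le> s - 1" using card_length[of es] es(1) by simp
      finally show False using s1 by simp
    qed
    then have "2 \<le> depth_quot (ideal_power I s)"
      unfolding pow by (rule depth_quot_ge_2[OF s1])
    ultimately show False by (simp add: one_enat_def numeral_eq_enat)
  qed
  then show ?thesis unfolding bound using le by auto
qed

end
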